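(* Let $\alpha\in\mathbb{R}$, $\alpha\neq -1$, and let $V\in C^1_sC^2_y(\mathbb{R}^{3+1})$, $V=V(y,s)=(V_1,V_2,V_3)$, be a time periodic solution, with period $S_0>0$, of the self-similar Euler system $$\frac{\partial V}{\partial s}+\frac{\alpha}{\alpha+1}V+\frac{1}{\alpha+1}(y\cdot\nabla)V+(V\cdot\nabla)V=-\nabla P,\qquad \operatorname{div}V=0,\qquad (y,s)\in\mathbb{R}^3\times\mathbb{R}.$$ Suppose there exists an open set $G\subset\mathbb{R}^3$ containing the origin such that $V=0$ on $G\times(0,S_0)$. Then $V=0$ on $\mathbb{R}^{3+1}$.
   Context: Points of $\mathbb{R}^{3+1}=\mathbb{R}^3\times\mathbb{R}$ are written $(y,s)$; $\nabla$ and $\operatorname{div}$ are taken with respect to $y$. $P=P(y,s)$ is a scalar pressure. The initial value $V(\cdot,0)=V_0$ is not otherwise prescribed. $V$ is a time periodic solution with period $S_0$ if, with its pressure $P$, it satisfies the system and $V(y,s)=V(y,s+S_0)$, $P(y,s)=P(y,s+S_0)$ for all $(y,s)\in\mathbb{R}^{3+1}$. $V\in C^1_sC^2_y(\mathbb{R}^{3+1})$ means that $V$ is $C^1$ in $s$ and $C^2$ in $y$: $V$ and $\partial_sV$ have continuous spatial derivatives up to order two. No boundedness or decay as $|y|\to\infty$ is assumed. *)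

theory Defs
  imports "HOL-Analysis.Analysis"
begin

definition partial :: "3 \<Rightarrow> (real^3 \<Rightarrow> 'b::real_normed_vector) \<Rightarrow> real^3 \<Rightarrow> 'b" where
  "partial j f y = vector_derivative (\<lambda>t. f (y + t *\<^sub>R axis j 1)) (at 0)"

definition grad :: "(real^3 \<Rightarrow> real) \<Rightarrow> real^3 \<Rightarrow> real^3" where
  "grad f y = (\<chi> j. partial j f y)"

definition divergence :: "(real^3 \<Rightarrow> real^3) \<Rightarrow> real^3 \<Rightarrow> real" where
  "divergence F y = (\<Sum>j\<in>UNIV. partial j F y $ j)"

text \<open>\<open>advect u F y\<close> is \<open>(u \<cdot> \<nabla>) F\<close> at the point \<open>y\<close>, where \<open>u\<close> is the value of the
  transporting field at \<open>y\<close>.\<close>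

definition advect :: "real^3 \<Rightarrow> (real^3 \<Rightarrow> real^3) \<Rightarrow> real^3 \<Rightarrow> real^3" where
  "advect u F y = (\<Sum>j\<in>UNIV. (u $ j) *\<^sub>R partial j F y)"

text \<open>\<open>U\<close> has spatial derivatives up to order two, all of them jointly continuous in \<open>(y, s)\<close>;
  \<open>DU\<close> and \<open>D2U\<close> are the first and second Frechet derivatives in \<open>y\<close>.\<close>

definition C2_space :: "(real^3 \<Rightarrow> real \<Rightarrow> real^3) \<Rightarrow> bool" where
  "C2_space U \<longleftrightarrow>
    (\<exists>(DU :: real^3 \<Rightarrow> real \<Rightarrow> ((real^3) \<Rightarrow>\<^sub>L (real^3)))
      (D2U :: real^3 \<Rightarrow> real \<Rightarrow> ((real^3) \<Rightarrow>\<^sub>L ((real^3) \<Rightarrow>\<^sub>L (real^3)))).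
      (\<forall>y s. ((\<lambda>z. U z s) has_derivative blinfun_apply (DU y s)) (at y)) \<and>
      (\<forall>y s. ((\<lambda>z. DU z s) has_derivative blinfun_apply (D2U y s)) (at y)) \<and>
      continuous_on UNIV (\<lambda>(y, s). U y s) \<and>
      continuous_on UNIV (\<lambda>(y, s). DU y s) \<and>
      continuous_on UNIV (\<lambda>(y, s). D2U y s))"

definition C1_time_C2_space :: "(real^3 \<Rightarrow> real \<Rightarrow> real^3) \<Rightarrow> bool" where
  "C1_time_C2_space V \<longleftrightarrow> C2_space V \<and>
    (\<exists>W. (\<forall>y s. ((\<lambda>t. V y t) has_vector_derivative W y s) (at s)) \<and> C2_space W)"

text \<open>The derivatives of \<open>V\<close> below are total functions and carry no existence claim: the predicate
  is meant for \<open>V\<close> satisfying \<open>C1_time_C2_space\<close>. For the pressure only the existence of the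
  spatial gradient is required.\<close>

definition self_similar_euler ::
  "real \<Rightarrow> (real^3 \<Rightarrow> real \<Rightarrow> real^3) \<Rightarrow> (real^3 \<Rightarrow> real \<Rightarrow> real) \<Rightarrow> bool" where
  "self_similar_euler \<alpha> V P \<longleftrightarrow>
    (\<forall>y s. (\<lambda>z. P z s) differentiable (at y)) \<and>
    (\<forall>y s. vector_derivative (\<lambda>t. V y t) (at s)
        + (\<alpha> / (\<alpha> + 1)) *\<^sub>R V y s
        + (1 / (\<alpha> + 1)) *\<^sub>R advect y (\<lambda>z. V z s) y
        + advect (V y s) (\<lambda>z. V z s) y
      = - grad (\<lambda>z. P z s) y) \<and>
    (\<forall>y s. divergence (\<lambda>z. V z s) y = 0)"

definition time_periodic_solution ::
  "real \<Rightarrow> real \<Rightarrow> (real^3 \<Rightarrow> real \<Rightarrow> real^3) \<Rightarrow> (real^3 \<Rightarrow> real \<Rightarrow> real) \<Rightarrow> bool" where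
  "time_periodic_solution \<alpha> S\<^sub>0 V P \<longleftrightarrow>
    self_similar_euler \<alpha> V P \<and>
    (\<forall>y s. V y s = V y (s + S\<^sub>0)) \<and>
    (\<forall>y s. P y s = P y (s + S\<^sub>0))"

end

theory Submission
  imports Defs "HOL-Library.Periodic_Fun"
begin

text \<open>Suppose \<open>V\<close> vanishes for \<open>|y| \<le> r\<close> at all times. By compactness of the period, \<open>V\<close> is so
  small for \<open>|y|\<close> slightly larger than \<open>r\<close> that the transporting field \<open>y / (\<alpha> + 1) + V\<close> is
  strictly outward (inward if \<open>\<alpha> < -1\<close>) there. The antisymmetric part of \<open>DV\<close> satisfies a linear
  transport equation along this field, so periodicity in time and a maximum principle with weight
  \<open>exp (- k |y|\<^sup>2)\<close> show that it vanishes on a larger ball. There \<open>V\<close> is curl free and divergence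
  free, so its components are harmonic, and vanish by unique continuation. Hence the largest ball
  on which \<open>V\<close> vanishes is the whole space.\<close>

subsection \<open>Unique continuation for harmonic functions\<close>

text \<open>Without boundedness or decay of \<open>V\<close> no energy estimate over the whole space
  is available, so every step takes place in a ball; with no prescribed initial value, periodicity
  takes over its role. Heuristically, trajectories of the transporting field that start in a thin
  shell reach the inner ball, backwards in time if \<alpha> > -1 and forwards if \<alpha> < -1, and
  the vorticity is zero there; the maximum principle expresses this without constructing the flow.
  The drift y/(\<alpha> + 1) is only known to dominate \<open>V\<close> close to a ball where
  \<open>V\<close> vanishes, so the ball has to grow in stages. The pressure is merely
  differentiable: its second derivatives come from the momentum equation, whose other terms are
  differentiable in space. Unique continuation is obtained without power series: moments against
  polynomials carry the vanishing from small radii to larger ones, and polynomial approximation then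
  recovers the function.\<close>

definition has_partial :: "'n \<Rightarrow> (real^'n::finite \<Rightarrow> real) \<Rightarrow> (real^'n \<Rightarrow> real) \<Rightarrow> bool" where
  "has_partial j f f' \<longleftrightarrow>
    (\<forall>x. ((\<lambda>t. f (x + t *\<^sub>R axis j 1)) has_real_derivative f' x) (at 0))"

lemma has_partialD_at:
  assumes "has_partial j f f'"
  shows "((\<lambda>t. f (x + t *\<^sub>R axis j 1)) has_real_derivative f' (x + t *\<^sub>R axis j 1)) (at t)"
proof -
  have "((\<lambda>h. f ((x + t *\<^sub>R axis j 1) + h *\<^sub>R axis j 1)) has_real_derivative f' (x + t *\<^sub>R axis j 1)) (at 0)"
    using assms unfolding has_partial_def by blast
  then show ?thesis
    using DERIV_at_within_shift[of "\<lambda>t. f (x + t *\<^sub>R axis j 1)" _ t 0 UNIV] by (simp add: algebra_simps)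
qed

lemma has_partial_coord: "has_partial j (\<lambda>x. x $ j) (\<lambda>x. 1)"
  unfolding has_partial_def by (auto simp: axis_def intro!: derivative_eq_intros)

lemma has_partial_const: "has_partial j (\<lambda>x. c) (\<lambda>x. 0)"
  unfolding has_partial_def by simp

lemma has_partial_add:
  assumes "has_partial j f f'" "has_partial j g g'"
  shows "has_partial j (\<lambda>x. f x + g x) (\<lambda>x. f' x + g' x)"
  using assms unfolding has_partial_def by (auto intro!: derivative_eq_intros)

lemma has_partial_diff:
  assumes "has_partial j f f'" "has_partial j g g'"
  shows "has_partial j (\<lambda>x. f x - g x) (\<lambda>x. f' x - g' x)"
  using assms unfolding has_partial_def by (auto intro!: derivative_eq_intros)

lemma has_partial_mult:
  assumes "has_partial j f f'" "has_partial j g g'"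
  shows "has_partial j (\<lambda>x. f x * g x) (\<lambda>x. f' x * g x + f x * g' x)"
  unfolding has_partial_def
proof
  fix x
  have "((\<lambda>t. f (x + t *\<^sub>R axis j 1)) has_real_derivative f' x) (at 0)"
    "((\<lambda>t. g (x + t *\<^sub>R axis j 1)) has_real_derivative g' x) (at 0)"
    using assms unfolding has_partial_def by blast+
  from DERIV_mult[OF this]
  show "((\<lambda>t. f (x + t *\<^sub>R axis j 1) * g (x + t *\<^sub>R axis j 1)) has_real_derivative f' x * g x + f x * g' x) (at 0)"
    by (simp add: algebra_simps)
qed

lemma has_partial_cmult:
  assumes "has_partial j f f'"
  shows "has_partial j (\<lambda>x. c * f x) (\<lambda>x. c * f' x)"
  using has_partial_mult[OF has_partial_const assms, of c] by simp

lemma has_partial_chain: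
  assumes "has_partial j f f'" "\<And>t. (\<phi> has_real_derivative \<phi>' t) (at t)"
  shows "has_partial j (\<lambda>x. \<phi> (f x)) (\<lambda>x. \<phi>' (f x) * f' x)"
  unfolding has_partial_def
proof
  fix x
  have "((\<lambda>t. f (x + t *\<^sub>R axis j 1)) has_real_derivative f' x) (at 0)"
    using assms unfolding has_partial_def by blast
  from DERIV_chain2[OF assms(2) this]
  show "((\<lambda>t. \<phi> (f (x + t *\<^sub>R axis j 1))) has_real_derivative \<phi>' (f x) * f' x) (at 0)"
    by simp
qed

lemma has_partial_norm_square: "has_partial (j::'n::finite) (\<lambda>x. (norm x)\<^sup>2) (\<lambda>x. 2 * x $ j)"
proof -
  have "(norm (x + t *\<^sub>R axis j 1))\<^sup>2 = (norm x)\<^sup>2 + 2 * t * x $ j + t\<^sup>2" for x :: "real^'n" and t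
    unfolding power2_norm_eq_inner
    by (simp add: inner_add inner_axis inner_axis' inner_axis_axis power2_eq_square algebra_simps)
  then show ?thesis
    unfolding has_partial_def by (auto intro!: derivative_eq_intros)
qed

section \<open>Test functions: truncated powers of \<rho> - |x|^2 and monomials\<close>

lemma DERIV_pos_part_power:
  assumes "n \<ge> 2"
  shows "((\<lambda>t::real. max 0 t ^ n) has_real_derivative real n * max 0 t ^ (n - 1)) (at t)"
proof -
  consider "t > 0" | "t < 0" | "t = 0" by linarith
  then show ?thesis
  proof cases
    case 1
    have "((\<lambda>t. t ^ n) has_real_derivative real n * t ^ (n - 1)) (at t)"
      by (auto intro!: derivative_eq_intros)
    then have "((\<lambda>t. max 0 t ^ n) has_real_derivative real n * t ^ (n - 1)) (at t)"
      by (rule has_field_derivative_transform_within_open[of _ _ _ "{0<..}"]) (use 1 in auto)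
    then show ?thesis using 1 by simp
  next
    case 2
    have "((\<lambda>t::real. 0) has_real_derivative 0) (at t)" by simp
    then have "((\<lambda>t. max 0 t ^ n) has_real_derivative 0) (at t)"
      by (rule has_field_derivative_transform_within_open[of _ _ _ "{..<0}"])
        (use 2 assms in \<open>auto simp: max_def\<close>)
    moreover have "real n * max 0 t ^ (n - 1) = 0" using 2 assms by simp
    ultimately show ?thesis by (simp only:)
  next
    \<comment> \<open>At the corner the difference quotient is itself a truncated power, of exponent
      \<open>n - 1\<close>; it tends to 0 because n \<ge> 2.\<close>
    case 3
    obtain m where n: "n = Suc m" "m > 0" using assms by (cases n) auto
    have "((\<lambda>h::real. max 0 h ^ (n - 1)) \<longlongrightarrow> max 0 0 ^ (n - 1)) (at 0)"
      by (intro tendsto_intros)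
    moreover have "\<forall>\<^sub>F h::real in at 0. max 0 h ^ (n - 1) = max 0 h ^ n / h"
      unfolding eventually_at_filter
      by (intro always_eventually) (use n(2) in \<open>auto simp: n(1) max_def\<close>)
    ultimately have "((\<lambda>h::real. max 0 h ^ n / h) \<longlongrightarrow> max 0 0 ^ (n - 1)) (at 0)"
      by (rule Lim_transform_eventually)
    moreover have "(0::real) ^ n = 0" "(0::real) ^ (n - Suc 0) = 0" using n by simp_all
    ultimately show ?thesis
      unfolding DERIV_def 3 by (simp only: add_0 max.idem diff_zero One_nat_def mult_zero_right)
  qed
qed

text \<open>The parameter \<open>\<rho>\<close> is a squared radius. Differentiating in
  \<open>x\<close> or in \<open>\<rho>\<close> lowers the exponent by one, so the family is closed
  under both, which is what turns Green's identity into a differential equation in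
  \<open>\<rho>\<close>.\<close>

definition bump :: "real \<Rightarrow> nat \<Rightarrow> real^'n::finite \<Rightarrow> real" where
  "bump \<rho> n x = max 0 (\<rho> - (norm x)\<^sup>2) ^ n"

lemma continuous_on_bump [continuous_intros]: "continuous_on S (bump \<rho> n)"
  unfolding bump_def by (intro continuous_intros)

lemma has_partial_bump:
  assumes "n \<ge> 2"
  shows "has_partial (j::'n::finite) (bump \<rho> n) (\<lambda>x. - 2 * real n * x $ j * bump \<rho> (n - 1) x)"
proof -
  have "has_partial j (\<lambda>x::real^'n. \<rho> - (norm x)\<^sup>2) (\<lambda>x. 0 - 2 * x $ j)"
    by (intro has_partial_diff has_partial_const has_partial_norm_square)
  from has_partial_chain[OF this DERIV_pos_part_power[OF assms]]
  show ?thesis unfolding bump_def by (simp add: algebra_simps)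
qed

definition monomial :: "('n \<Rightarrow> nat) \<Rightarrow> real^'n::finite \<Rightarrow> real" where
  "monomial e x = (\<Prod>i\<in>UNIV. x $ i ^ e i)"

lemma continuous_on_monomial [continuous_intros]: "continuous_on S (monomial e)"
  unfolding monomial_def by (intro continuous_intros)

lemma monomial_split:
  "monomial e x = x $ j ^ e j * (\<Prod>i\<in>UNIV - {j}. x $ i ^ e i)"
  unfolding monomial_def by (subst prod.remove[of UNIV j]) auto

lemma has_partial_monomial:
  "has_partial j (monomial e) (\<lambda>x. real (e j) * monomial (e(j := e j - 1)) x)"
proof -
  have "((\<lambda>t. monomial e (x + t *\<^sub>R axis j 1)) has_real_derivative
      real (e j) * monomial (e(j := e j - 1)) x) (at 0)" for x
  proof -
    have *: "monomial e (x + t *\<^sub>R axis j 1) = (x $ j + t) ^ e j * (\<Prod>i\<in>UNIV - {j}. x $ i ^ e i)" for t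
      by (subst monomial_split[of _ _ j]) (auto simp: axis_def intro!: prod.cong)
    have "monomial (e(j := e j - 1)) x = x $ j ^ (e j - 1) * (\<Prod>i\<in>UNIV - {j}. x $ i ^ e i)"
      by (subst monomial_split[of _ _ j]) (auto intro!: prod.cong)
    then show ?thesis unfolding *
      by (auto intro!: derivative_eq_intros)
  qed
  then show ?thesis unfolding has_partial_def by blast
qed

text \<open>Euler's relation in one variable. The factor \<open>real (e j)\<close> is kept on both
  sides because for \<open>e j = 0\<close> the truncated exponent \<open>e j - 1\<close> is again 0
  and the relation without the factor fails.\<close>

lemma coord_times_monomial:
  "real (e j) * (x $ j * monomial (e(j := e j - 1)) x) = real (e j) * monomial e x"
proof (cases "e j")
  case (Suc k)
  have "monomial (e(j := e j - 1)) x = x $ j ^ k * (\<Prod>i\<in>UNIV - {j}. x $ i ^ e i)"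
    by (subst monomial_split[of _ _ j]) (auto simp: Suc intro!: prod.cong)
  then show ?thesis
    by (simp add: monomial_split[of e x j] Suc)
qed simp

section \<open>Integration by parts over a cube\<close>

lemma cube_supset_ball:
  fixes x :: "real^'n::finite"
  assumes "norm x \<le> M"
  shows "x \<in> cbox (\<chi> i. - M) (\<chi> i. M)"
proof -
  have "\<bar>x $ i\<bar> \<le> M" for i using component_le_norm_cart[of x i] assms by linarith
  then show ?thesis unfolding mem_box_cart by (auto simp: abs_le_iff minus_le_iff)
qed

text \<open>Translating \<open>g\<close> along the axis by less than \<open>M - L\<close> keeps its
  support inside the cube and so does not change its integral; differentiating this constant under
  the integral sign gives the integral of \<open>h\<close>.\<close>

lemma integral_has_partial_eq_0:
  fixes g h :: "real^'n::finite \<Rightarrow> real"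
  assumes p: "has_partial j g h" and cg: "continuous_on UNIV g" and ch: "continuous_on UNIV h"
    and supp: "\<And>x. norm x \<ge> L \<Longrightarrow> g x = 0" and LM: "L < M"
  shows "integral (cbox (\<chi> i. - M) (\<chi> i. M)) h = 0"
proof -
  let ?K = "cbox (\<chi> i. - M) (\<chi> i. M) :: (real^'n) set"
  let ?J = "\<lambda>t. integral ?K (\<lambda>x. g (x + t *\<^sub>R axis j 1))"
  let ?U = "{-(M - L)<..<M - L}"
  have J: "?J t = integral UNIV g" if "t \<in> ?U" for t
  proof -
    let ?K' = "cbox ((\<chi> i. - M) + t *\<^sub>R axis j 1) ((\<chi> i. M) + t *\<^sub>R axis j 1) :: (real^'n) set"
    have "g x = 0" if "x \<notin> ?K'" for x
    proof (rule supp, rule ccontr)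
      assume "\<not> L \<le> norm x"
      then have "norm (x - t *\<^sub>R axis j 1) \<le> M"
        using norm_triangle_ineq4[of x "t *\<^sub>R axis j 1"] \<open>t \<in> ?U\<close> by auto
      from cube_supset_ball[OF this] that show False
        unfolding mem_box_cart by (auto simp: algebra_simps)
    qed
    then have g: "(\<lambda>x. if x \<in> ?K' then g x else 0) = g" by auto
    have "?J t = integral ?K' g"
      by (subst integral_shift_cbox_plus[symmetric]) (simp add: o_def add.commute)
    also have "\<dots> = integral UNIV g"
      by (subst integral_restrict_UNIV[symmetric]) (simp only: g)
    finally show ?thesis .
  qed
  have "(?J has_field_derivative integral ?K (\<lambda>x. h (x + 0 *\<^sub>R axis j 1))) (at 0 within ?U)"
  proof (rule leibniz_rule_field_derivative)
    show "((\<lambda>t. g (x + t *\<^sub>R axis j 1)) has_real_derivative h (x + t *\<^sub>R axis j 1)) (at t within ?U)" for t x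
      using has_partialD_at[OF p] by (rule has_field_derivative_at_within)
    show "(\<lambda>x. g (x + t *\<^sub>R axis j 1)) integrable_on ?K" for t
      by (intro integrable_continuous continuous_on_compose2[OF cg] continuous_intros) auto
    show "continuous_on (?U \<times> ?K) (\<lambda>(t, x). h (x + t *\<^sub>R axis j 1))"
      unfolding split_beta by (intro continuous_on_compose2[OF ch] continuous_intros) auto
  qed (use LM in auto)
  then have "(?J has_field_derivative integral ?K h) (at 0)"
    by (subst (asm) at_within_open) (use LM in auto)
  moreover have "(?J has_field_derivative 0) (at 0)"
    by (rule has_field_derivative_transform_within_open[of "\<lambda>_. integral UNIV g" 0 0 ?U])
      (use LM J in auto)
  ultimately show ?thesis by (rule DERIV_unique)
qed

text \<open>The function f u1 - f1 u has compact support through \<open>f\<close> alone, and its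
  partial derivative is f u2 - f2 u. Treating one coordinate at a time leaves only a finite sum to
  form for the Laplacian.\<close>

lemma Green_identity_partial:
  fixes f u :: "real^'n::finite \<Rightarrow> real"
  assumes f: "has_partial j f f1" "has_partial j f1 f2" "continuous_on UNIV f" "continuous_on UNIV f1" "continuous_on UNIV f2"
    and u: "has_partial j u u1" "has_partial j u1 u2" "continuous_on UNIV u" "continuous_on UNIV u1" "continuous_on UNIV u2"
    and supp: "\<And>x. norm x \<ge> L \<Longrightarrow> f x = 0" "\<And>x. norm x \<ge> L \<Longrightarrow> f1 x = 0" and LM: "L < M"
  shows "integral (cbox (\<chi> i. - M) (\<chi> i. M)) (\<lambda>x. f x * u2 x) = integral (cbox (\<chi> i. - M) (\<chi> i. M)) (\<lambda>x. f2 x * u x)"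
proof -
  let ?K = "cbox (\<chi> i. - M) (\<chi> i. M) :: (real^'n) set"
  have "has_partial j (\<lambda>x. f x * u1 x - f1 x * u x) (\<lambda>x. f1 x * u1 x + f x * u2 x - (f2 x * u x + f1 x * u1 x))"
    by (intro has_partial_diff has_partial_mult f u)
  then have "has_partial j (\<lambda>x. f x * u1 x - f1 x * u x) (\<lambda>x. f x * u2 x - f2 x * u x)"
    by (simp add: algebra_simps)
  then have "integral ?K (\<lambda>x. f x * u2 x - f2 x * u x) = 0"
    by (rule integral_has_partial_eq_0) (use supp LM in \<open>auto intro!: continuous_intros f u\<close>)
  moreover have "integral ?K (\<lambda>x. f x * u2 x - f2 x * u x) = integral ?K (\<lambda>x. f x * u2 x) - integral ?K (\<lambda>x. f2 x * u x)"
    by (intro integral_diff integrable_continuous continuous_on_mult)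
      (use f u in \<open>auto intro: continuous_on_subset\<close>)
  ultimately show ?thesis by simp
qed

section \<open>Moments of a harmonic function\<close>

lemma bump_eq_0: "\<lbrakk>\<rho> \<le> (norm x)\<^sup>2; n > 0\<rbrakk> \<Longrightarrow> bump \<rho> n x = 0"
  unfolding bump_def by simp

text \<open>Write |x|^2 = \<rho> - (\<rho> - |x|^2). For \<open>n = 0\<close> the bump is 1 even
  outside the ball, where the identity would fail.\<close>

lemma norm_square_times_bump:
  assumes "n > 0"
  shows "(norm x)\<^sup>2 * bump \<rho> n x = \<rho> * bump \<rho> n x - bump \<rho> (Suc n) x"
  using assms by (cases "(norm x)\<^sup>2 \<le> \<rho>") (auto simp: bump_def algebra_simps)

text \<open>Differentiating the monomial twice gives monomials of degree two less. The cross terms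
  reproduce the monomial, by Euler's relation, and add up to its degree. The second derivatives of
  the bump produce |x|^2 \<open>bump \<rho> (n - 1)\<close>, which splits into orders
  \<open>n - 1\<close> and \<open>n\<close>; the latter part is the summand \<open>n\<close> in the
  middle coefficient.\<close>

lemma laplacian_monomial_times_bump:
  fixes e :: "'n::finite \<Rightarrow> nat" and \<rho> :: real
  assumes n: "n \<ge> 2"
  defines "F1 \<equiv> \<lambda>j x. real (e j) * monomial (e(j := e j - 1)) x * bump \<rho> (n + 1) x
             + monomial e x * (- 2 * real (n + 1) * x $ j * bump \<rho> n x)"
    and "F2 \<equiv> \<lambda>j x. real (e j) * real (e j - 1) * (monomial (e(j := e j - 2)) x * bump \<rho> (n + 1) x)
             - 2 * real (n + 1) * (2 * real (e j) + 1) * (monomial e x * bump \<rho> n x)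
             + 4 * real (n + 1) * real n * (x $ j)\<^sup>2 * (monomial e x * bump \<rho> (n - 1) x)"
  shows "has_partial j (\<lambda>x. monomial e x * bump \<rho> (n + 1) x) (F1 j)"
    and "has_partial j (F1 j) (F2 j)"
    and "(\<Sum>j\<in>UNIV. F2 j x) =
      (\<Sum>j\<in>UNIV. real (e j) * real (e j - 1) * (monomial (e(j := e j - 2)) x * bump \<rho> (n + 1) x))
      - 4 * real (n + 1) * (real (\<Sum>j\<in>UNIV. e j) + CARD('n) / 2 + n) * (monomial e x * bump \<rho> n x)
      + 4 * real (n + 1) * real n * \<rho> * (monomial e x * bump \<rho> (n - 1) x)"
proof -
  show "has_partial j (\<lambda>x. monomial e x * bump \<rho> (n + 1) x) (F1 j)"
    using has_partial_mult[OF has_partial_monomial has_partial_bump[of "n + 1"]] n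
    unfolding F1_def by simp
  have aux: "(k * (a * M)) * C + (k * m') * (- 2 * N * y * B)
       + ((k * m') * (- 2 * N * y * B) + m * ((- 2 * N * 1) * B + (- 2 * N * y) * (- 2 * l * y * B')))
     = k * a * (M * C) - 2 * N * (2 * k + 1) * (m * B) + 4 * N * l * y\<^sup>2 * (m * B')"
    if "k * (y * m') = k * m" for k a M C m' N y B m l B' :: real
  proof -
    have "(k * (a * M)) * C + (k * m') * (- 2 * N * y * B)
       + ((k * m') * (- 2 * N * y * B) + m * ((- 2 * N * 1) * B + (- 2 * N * y) * (- 2 * l * y * B')))
      = k * a * (M * C) - 4 * N * B * (k * (y * m')) - 2 * N * (m * B) + 4 * N * l * y\<^sup>2 * (m * B')"
      by (simp add: algebra_simps power2_eq_square)
    then show ?thesis unfolding that by (simp add: algebra_simps)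
  qed
  have "has_partial j (F1 j)
     (\<lambda>x. (real (e j) * (real (e j - 1) * monomial (e(j := e j - 2)) x)) * bump \<rho> (n + 1) x
       + (real (e j) * monomial (e(j := e j - 1)) x) * (- 2 * real (n + 1) * x $ j * bump \<rho> n x)
       + ((real (e j) * monomial (e(j := e j - 1)) x) * (- 2 * real (n + 1) * x $ j * bump \<rho> n x)
         + monomial e x * ((- 2 * real (n + 1) * 1) * bump \<rho> n x
              + (- 2 * real (n + 1) * x $ j) * (- 2 * real n * x $ j * bump \<rho> (n - 1) x))))"
    unfolding F1_def
    using has_partial_monomial[of j "e(j := e j - 1)"] has_partial_bump[of "n + 1" j \<rho>] n
    by (intro has_partial_add has_partial_mult has_partial_cmult has_partial_coord
         has_partial_monomial has_partial_bump) (simp_all add: numeral_2_eq_2)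
  also have "?this \<longleftrightarrow> has_partial j (F1 j) (F2 j)"
  proof (rule arg_cong[of _ _ "has_partial j (F1 j)"], rule ext)
    fix x
    show "(real (e j) * (real (e j - 1) * monomial (e(j := e j - 2)) x)) * bump \<rho> (n + 1) x
       + (real (e j) * monomial (e(j := e j - 1)) x) * (- 2 * real (n + 1) * x $ j * bump \<rho> n x)
       + ((real (e j) * monomial (e(j := e j - 1)) x) * (- 2 * real (n + 1) * x $ j * bump \<rho> n x)
         + monomial e x * ((- 2 * real (n + 1) * 1) * bump \<rho> n x
              + (- 2 * real (n + 1) * x $ j) * (- 2 * real n * x $ j * bump \<rho> (n - 1) x))) = F2 j x"
      unfolding F2_def by (rule aux[OF coord_times_monomial])
  qed
  finally show "has_partial j (F1 j) (F2 j)" .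
  have sq: "(\<Sum>j\<in>UNIV. (x $ j)\<^sup>2) = (norm x)\<^sup>2"
    by (simp add: norm_vec_def L2_set_def sum_nonneg)
  have *: "(norm x)\<^sup>2 * bump \<rho> (n - 1) x = \<rho> * bump \<rho> (n - 1) x - bump \<rho> n x"
    using norm_square_times_bump[of "n - 1" x \<rho>] n by simp
  have "(\<Sum>j\<in>UNIV. F2 j x) =
      (\<Sum>j\<in>UNIV. real (e j) * real (e j - 1) * (monomial (e(j := e j - 2)) x * bump \<rho> (n + 1) x))
      - 2 * real (n + 1) * (2 * real (\<Sum>j\<in>UNIV. e j) + CARD('n)) * (monomial e x * bump \<rho> n x)
      + 4 * real (n + 1) * real n * (monomial e x * ((norm x)\<^sup>2 * bump \<rho> (n - 1) x))"
    unfolding F2_def sq[symmetric]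
    by (simp add: sum.distrib sum_subtractf sum_distrib_left sum_distrib_right algebra_simps)
  then show "(\<Sum>j\<in>UNIV. F2 j x) =
      (\<Sum>j\<in>UNIV. real (e j) * real (e j - 1) * (monomial (e(j := e j - 2)) x * bump \<rho> (n + 1) x))
      - 4 * real (n + 1) * (real (\<Sum>j\<in>UNIV. e j) + CARD('n) / 2 + n) * (monomial e x * bump \<rho> n x)
      + 4 * real (n + 1) * real n * \<rho> * (monomial e x * bump \<rho> (n - 1) x)"
    unfolding * by (simp add: algebra_simps)
qed

text \<open>The moments \<open>I\<^sub>n(\<rho>)\<close> of \<open>u\<close> against \<open>monomial e * bump \<rho> n\<close> satisfy
  \<open>\<rho> I\<^sub>n' = \<gamma> I\<^sub>n\<close> by Green's identity (the lower order moments vanish by induction), and vanish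
  for small \<open>\<rho>\<close>.\<close>

lemma harmonic_moment_eq_0:
  fixes u :: "real^'n::finite \<Rightarrow> real"
  assumes p1: "\<And>j. has_partial j u (u1 j)" and p2: "\<And>j. has_partial j (u1 j) (u2 j)"
    and cu: "continuous_on UNIV u" and cu1: "\<And>j. continuous_on UNIV (u1 j)"
    and cu2: "\<And>j. continuous_on UNIV (u2 j)"
    and harm: "\<And>x. norm x < R \<Longrightarrow> (\<Sum>j\<in>UNIV. u2 j x) = 0"
    and zero: "\<And>x. norm x < r \<Longrightarrow> u x = 0"
    and r: "0 < r" and R: "0 < R" "R \<le> M"
  shows "\<lbrakk>n \<ge> 2; \<rho> < R\<^sup>2\<rbrakk> \<Longrightarrow>
    integral (cbox (\<chi> i. - M) (\<chi> i. M)) (\<lambda>x. u x * (monomial e x * bump \<rho> n x)) = 0"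
proof (induction "\<Sum>j\<in>UNIV. e j" arbitrary: e n \<rho> rule: less_induct)
  \<comment> \<open>The induction is on the degree of the monomial with \<open>n\<close> and
    \<open>\<rho>\<close> free, because Green's identity lowers the degree by two but pairs the
    result with the bump of exponent \<open>n + 1\<close>.\<close>
  case (less e n \<rho>')
  let ?K = "cbox (\<chi> i. - M) (\<chi> i. M) :: (real^'n) set"
  let ?I = "\<lambda>n \<rho>. integral ?K (\<lambda>x. u x * (monomial e x * bump \<rho> n x))"
  have cu': "continuous_on S u" "continuous_on S (u1 j)" "continuous_on S (u2 j)" for S j
    using cu cu1 cu2 continuous_on_subset by blast+
  have int: "(\<lambda>x. u x * (monomial e x * bump \<rho> n x)) integrable_on ?K" for e n \<rho>
    by (intro integrable_continuous continuous_intros cu')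
  \<comment> \<open>This is the power of \<open>\<rho>\<close> by which the moment scales when
    \<open>u\<close> is a homogeneous harmonic polynomial of the same degree as the monomial: half
    of twice that degree plus the dimension, plus \<open>n\<close>.\<close>
  define \<gamma> where "\<gamma> = real (\<Sum>j\<in>UNIV. e j) + CARD('n) / 2 + n"
  have ode: "\<rho> * (real n * ?I (n - 1) \<rho>) = \<gamma> * ?I n \<rho>" if \<rho>: "0 < \<rho>" "\<rho> < R\<^sup>2" for \<rho>
  proof -
    \<comment> \<open>With exponent \<open>n + 1\<close>, two derivatives bring in the bumps of
      order \<open>n\<close> and \<open>n - 1\<close>, whose moments the equation relates.\<close>
    define F where "F = (\<lambda>x. monomial e x * bump \<rho> (n + 1) x)"
    define F1 where "F1 j = (\<lambda>x. real (e j) * monomial (e(j := e j - 1)) x * bump \<rho> (n + 1) x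
             + monomial e x * (- 2 * real (n + 1) * x $ j * bump \<rho> n x))" for j
    define F2 where "F2 j = (\<lambda>x. real (e j) * real (e j - 1) * (monomial (e(j := e j - 2)) x * bump \<rho> (n + 1) x)
             - 2 * real (n + 1) * (2 * real (e j) + 1) * (monomial e x * bump \<rho> n x)
             + 4 * real (n + 1) * real n * (x $ j)\<^sup>2 * (monomial e x * bump \<rho> (n - 1) x))" for j
    note lap = laplacian_monomial_times_bump[OF less.prems(1), where e = e and \<rho> = \<rho>,
        folded F_def F1_def F2_def]
    have lap3: "(\<Sum>j\<in>UNIV. F2 j x) =
      (\<Sum>j\<in>UNIV. real (e j) * real (e j - 1) * (monomial (e(j := e j - 2)) x * bump \<rho> (n + 1) x))
      - 4 * real (n + 1) * \<gamma> * (monomial e x * bump \<rho> n x)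
      + 4 * real (n + 1) * real n * \<rho> * (monomial e x * bump \<rho> (n - 1) x)" for x
      unfolding F2_def \<gamma>_def by (rule laplacian_monomial_times_bump(3)[OF less.prems(1)])
    have cF: "continuous_on S F" "continuous_on S (F1 j)" "continuous_on S (F2 j)" for S j
      unfolding F_def F1_def F2_def by (intro continuous_intros)+
    have far: "\<rho> \<le> (norm x)\<^sup>2" if "norm x \<ge> sqrt \<rho>" for x :: "real^'n"
      using that \<rho> by (metis less_le_not_le nle_le power2_eq_square real_sqrt_ge_0_iff real_sqrt_pow2 power_mono)
    have "sqrt \<rho> < M"
      using \<rho> R real_sqrt_less_mono[of \<rho> "R\<^sup>2"] by simp
    have green: "integral ?K (\<lambda>x. F x * u2 j x) = integral ?K (\<lambda>x. F2 j x * u x)" for j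
    proof (rule Green_identity_partial[OF lap(1,2) cF p1 p2 cu cu1 cu2 _ _ \<open>sqrt \<rho> < M\<close>])
      fix x :: "real^'n" assume "sqrt \<rho> \<le> norm x"
      from far[OF this] show "F x = 0" "F1 j x = 0"
        using less.prems(1) by (auto simp: F_def F1_def bump_eq_0)
    qed
    have "(\<Sum>j\<in>UNIV. integral ?K (\<lambda>x. F2 j x * u x)) = integral ?K (\<lambda>x. \<Sum>j\<in>UNIV. F x * u2 j x)"
      unfolding green[symmetric]
      by (intro integral_sum[symmetric] integrable_continuous continuous_on_mult cF cu') auto
    \<comment> \<open>Harmonicity is known only for |x| < R, but \<open>F\<close> vanishes elsewhere
      since \<rho> < R^2.\<close>
    also have "(\<lambda>x. \<Sum>j\<in>UNIV. F x * u2 j x) = (\<lambda>x. 0)"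
    proof
      fix x
      show "(\<Sum>j\<in>UNIV. F x * u2 j x) = 0"
      proof (cases "norm x < R")
        case True
        then show ?thesis using harm by (simp flip: sum_distrib_left)
      next
        case False
        then have "R\<^sup>2 \<le> (norm x)\<^sup>2" using R by (intro power_mono) auto
        then have "F x = 0" using \<rho> by (simp add: F_def bump_eq_0)
        then show ?thesis by simp
      qed
    qed
    finally have "0 = (\<Sum>j\<in>UNIV. integral ?K (\<lambda>x. F2 j x * u x))" by simp
    also have "\<dots> = integral ?K (\<lambda>x. (\<Sum>j\<in>UNIV. F2 j x) * u x)"
      unfolding sum_distrib_right
      by (intro integral_sum[symmetric] integrable_continuous continuous_on_mult cF cu') auto
    also have "\<dots> = integral ?K (\<lambda>x.
      (\<Sum>j\<in>UNIV. real (e j) * real (e j - 1) * (u x * (monomial (e(j := e j - 2)) x * bump \<rho> (n + 1) x)))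
      - 4 * real (n + 1) * \<gamma> * (u x * (monomial e x * bump \<rho> n x))
      + 4 * real (n + 1) * real n * \<rho> * (u x * (monomial e x * bump \<rho> (n - 1) x)))"
      unfolding lap3
      by (rule integral_cong) (simp add: algebra_simps sum_distrib_left)
    also have "\<dots> = (\<Sum>j\<in>UNIV. real (e j) * real (e j - 1) *
          integral ?K (\<lambda>x. u x * (monomial (e(j := e j - 2)) x * bump \<rho> (n + 1) x)))
      - 4 * real (n + 1) * \<gamma> * ?I n \<rho> + 4 * real (n + 1) * real n * \<rho> * ?I (n - 1) \<rho>"
      by (intro integral_unique has_integral_add has_integral_diff has_integral_sum
          has_integral_mult_right integrable_integral int finite)
    also have "(\<Sum>j\<in>UNIV. real (e j) * real (e j - 1) *
          integral ?K (\<lambda>x. u x * (monomial (e(j := e j - 2)) x * bump \<rho> (n + 1) x))) = 0"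
    proof (intro sum.neutral ballI)
      fix j
      show "real (e j) * real (e j - 1) *
          integral ?K (\<lambda>x. u x * (monomial (e(j := e j - 2)) x * bump \<rho> (n + 1) x)) = 0"
      \<comment> \<open>For exponents 0 and 1 the prefactor is zero, so the truncated exponent
        \<open>e j - 2\<close> matters only where it is a true difference.\<close>
      proof (cases "e j < 2")
        case False
        have "(\<Sum>i\<in>UNIV. (e(j := e j - 2)) i) < (\<Sum>i\<in>UNIV. e i)"
          by (rule sum_strict_mono_ex1) (use False in \<open>auto intro!: bexI[of _ j]\<close>)
        then have "integral ?K (\<lambda>x. u x * (monomial (e(j := e j - 2)) x * bump \<rho> (n + 1) x)) = 0"
          by (rule less.hyps) (use less.prems(1) \<rho> in auto)
        then show ?thesis by simp
      qed (auto simp: less_2_cases_iff)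
    qed
    finally have "4 * real (n + 1) * (\<rho> * (real n * ?I (n - 1) \<rho>) - \<gamma> * ?I n \<rho>) = 0"
      by (simp add: algebra_simps)
    then show ?thesis by simp
  qed
  have deriv: "(?I n has_real_derivative real n * ?I (n - 1) \<rho>) (at \<rho>)" for \<rho>
  proof -
    have "(?I n has_real_derivative
        integral ?K (\<lambda>x. real n * (u x * (monomial e x * bump \<rho> (n - 1) x)))) (at \<rho> within UNIV)"
    proof (rule leibniz_rule_field_derivative)
      fix \<rho> :: real and x :: "real^'n"
      have "((\<lambda>\<rho>. \<rho> - (norm x)\<^sup>2) has_real_derivative 1) (at \<rho>)"
        by (auto intro!: derivative_eq_intros)
      from DERIV_chain2[OF DERIV_pos_part_power[OF less.prems(1)] this]
      have "((\<lambda>\<rho>. bump \<rho> n x) has_real_derivative real n * bump \<rho> (n - 1) x) (at \<rho>)"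
        unfolding bump_def by simp
      from DERIV_cmult[OF this, of "u x * monomial e x"]
      show "((\<lambda>\<rho>. u x * (monomial e x * bump \<rho> n x)) has_real_derivative
          real n * (u x * (monomial e x * bump \<rho> (n - 1) x))) (at \<rho> within UNIV)"
        by (simp add: algebra_simps)
    next
      show "(\<lambda>x. u x * (monomial e x * bump \<rho> n x)) integrable_on ?K" for \<rho>
        by (rule int)
      have *: "continuous_on (UNIV \<times> ?K) (\<lambda>p. u (snd p))"
        "continuous_on (UNIV \<times> ?K) (\<lambda>p. monomial e (snd p))"
        by (rule continuous_on_compose2[OF cu'(1)[of UNIV]]
            continuous_on_compose2[OF continuous_on_monomial[of UNIV]]; auto intro!: continuous_intros)+
      show "continuous_on (UNIV \<times> ?K) (\<lambda>(\<rho>, x). real n * (u x * (monomial e x * bump \<rho> (n - 1) x)))"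
        unfolding split_beta bump_def by (intro continuous_intros *)
    qed auto
    then show ?thesis by simp
  qed
  have small: "?I n \<rho> = 0" if "\<rho> \<le> r\<^sup>2" for \<rho>
  proof -
    have "u x * (monomial e x * bump \<rho> n x) = 0" for x
    proof (cases "norm x < r")
      case False
      then have "r\<^sup>2 \<le> (norm x)\<^sup>2" using r by (intro power_mono) auto
      then show ?thesis using that less.prems(1) by (simp add: bump_eq_0)
    qed (simp add: zero)
    then show ?thesis by (simp only: integral_0)
  qed
  show ?case
  proof (cases "\<rho>' \<le> r\<^sup>2")
    case False
    have pos: "0 < r\<^sup>2" using r by simp
    \<comment> \<open>\<open>\<rho> powr (- \<gamma>)\<close> is the integrating factor of the
      equation; the constant is then read off at \<open>r\<^sup>2\<close>, where the bump is
      supported in the region where \<open>u\<close> is zero.\<close>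
    have "\<exists>c. \<forall>\<rho>\<in>{0<..<R\<^sup>2}. ?I n \<rho> * \<rho> powr (- \<gamma>) = c"
    proof (rule has_field_derivative_zero_constant)
      fix \<rho> assume \<rho>: "\<rho> \<in> {0<..<R\<^sup>2}"
      have deriv': "((\<lambda>\<rho>. ?I n \<rho> * \<rho> powr (- \<gamma>)) has_real_derivative
          ?I n \<rho> * (- \<gamma> * \<rho> powr (- \<gamma> - 1)) + real n * ?I (n - 1) \<rho> * \<rho> powr (- \<gamma>)) (at \<rho>)"
        by (rule DERIV_mult'[OF deriv has_real_derivative_powr]) (use \<rho> in simp)
      have powr: "\<rho> powr (- \<gamma>) = \<rho> * \<rho> powr (- \<gamma> - 1)"
        using \<rho> by (simp add: powr_diff)
      have alg: "I * (- g * q) + J * p = q * (\<rho> * J - g * I)" if "p = \<rho> * q" for I g q J p :: real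
        unfolding that by (simp add: algebra_simps)
      have "?I n \<rho> * (- \<gamma> * \<rho> powr (- \<gamma> - 1)) + real n * ?I (n - 1) \<rho> * \<rho> powr (- \<gamma>)
        = \<rho> powr (- \<gamma> - 1) * (\<rho> * (real n * ?I (n - 1) \<rho>) - \<gamma> * ?I n \<rho>)"
        by (rule alg[OF powr])
      then have "?I n \<rho> * (- \<gamma> * \<rho> powr (- \<gamma> - 1)) + real n * ?I (n - 1) \<rho> * \<rho> powr (- \<gamma>) = 0"
        using ode[of \<rho>] \<rho> by simp
      with deriv' show "((\<lambda>\<rho>. ?I n \<rho> * \<rho> powr (- \<gamma>)) has_real_derivative 0) (at \<rho> within {0<..<R\<^sup>2})"
        by (simp only: has_field_derivative_at_within)
    qed auto
    then obtain c where c: "\<And>\<rho>. \<rho> \<in> {0<..<R\<^sup>2} \<Longrightarrow> ?I n \<rho> * \<rho> powr (- \<gamma>) = c"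
      by blast
    have "c = 0" using c[of "r\<^sup>2"] small[of "r\<^sup>2"] pos False less.prems(2) by simp
    then show ?thesis using c[of \<rho>'] pos False less.prems(2) by simp
  qed (rule small)
qed

section \<open>From vanishing moments to a vanishing function\<close>

lemma linear_vec_expansion:
  fixes L :: "real^'n::finite \<Rightarrow> 'b::real_vector"
  assumes "linear L"
  shows "L v = (\<Sum>k\<in>UNIV. v $ k *\<^sub>R L (axis k 1))"
proof -
  have "L v = L (\<Sum>k\<in>UNIV. v $ k *\<^sub>R axis k 1)"
    using basis_expansion[of v] by (simp add: scalar_mult_eq_scaleR)
  then show ?thesis by (simp add: linear_sum[OF assms] linear_cmul[OF assms])
qed

text \<open>This links the polynomial functions of the Stone-Weierstrass theorem to the monomials of
  the moments. The two rules are exactly the operations under which a vanishing integral is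
  inherited.\<close>

inductive monomial_span :: "(real^'n::finite \<Rightarrow> real) \<Rightarrow> bool" where
  monomial: "monomial_span (\<lambda>x. c * monomial e x)"
| add: "\<lbrakk>monomial_span f; monomial_span g\<rbrakk> \<Longrightarrow> monomial_span (\<lambda>x. f x + g x)"

lemma monomial_span_const: "monomial_span (\<lambda>x. c)"
  using monomial_span.monomial[of c "\<lambda>_. 0"] by (simp add: monomial_def)

lemma monomial_span_sum:
  "finite A \<Longrightarrow> (\<And>i. i \<in> A \<Longrightarrow> monomial_span (f i)) \<Longrightarrow> monomial_span (\<lambda>x. \<Sum>i\<in>A. f i x)"
proof (induction A rule: finite_induct)
  case (insert i A)
  then show ?case using monomial_span.add[of "f i" "\<lambda>x. \<Sum>i\<in>A. f i x"] by simp
qed (simp add: monomial_span_const)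

lemma monomial_span_mult:
  assumes "monomial_span f" "monomial_span g"
  shows "monomial_span (\<lambda>x. f x * g x)"
  using assms(1)
proof induction
  case (monomial c e)
  show ?case
    using assms(2)
  proof induction
    case (monomial c' e')
    show ?case
      using monomial_span.monomial[of "c * c'" "\<lambda>i. e i + e' i"]
      by (simp add: monomial_def power_add prod.distrib algebra_simps)
  next
    case (add g g')
    show ?case using monomial_span.add[OF add.IH] by (simp add: distrib_left)
  qed
next
  case (add f f')
  show ?case using monomial_span.add[OF add.IH] by (simp add: distrib_right)
qed

lemma monomial_span_real_polynomial_function:
  fixes p :: "real^'n::finite \<Rightarrow> real"
  assumes "real_polynomial_function p"
  shows "monomial_span p"
  using assms
proof induction
  case (linear f)
  have "f x = (\<Sum>i\<in>UNIV. f (axis i 1) * monomial (\<lambda>k. if k = i then 1 else 0) x)" for x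
  proof -
    have "monomial (\<lambda>k. if k = i then 1 else 0) x = x $ i" for i
      unfolding monomial_def by (subst prod.remove[of UNIV i]) auto
    then show ?thesis
      using linear_vec_expansion[OF bounded_linear.linear[OF linear], of x] by (simp add: mult.commute)
  qed
  then have "f = (\<lambda>x. \<Sum>i\<in>UNIV. f (axis i 1) * monomial (\<lambda>k. if k = i then 1 else 0) x)" ..
  moreover have "monomial_span (\<lambda>x. \<Sum>i\<in>UNIV. f (axis i 1) * monomial (\<lambda>k. if k = i then 1 else 0) x)"
    by (intro monomial_span_sum monomial_span.monomial finite)
  ultimately show ?case by (rule ssubst[where P = monomial_span])
qed (rule monomial_span_const monomial_span.add monomial_span_mult; assumption)+

text \<open>By the vanishing moments, \<open>u\<close> times a bump is orthogonal to every
  polynomial. Approximating \<open>u\<close> uniformly by polynomials on the cube makes the integral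
  of u^2 times the bump zero, hence \<open>u\<close> is zero where the bump is positive.\<close>

theorem harmonic_unique_continuation:
  fixes u :: "real^'n::finite \<Rightarrow> real"
  assumes p1: "\<And>j. has_partial j u (u1 j)" and p2: "\<And>j. has_partial j (u1 j) (u2 j)"
    and cu: "continuous_on UNIV u" and cu1: "\<And>j. continuous_on UNIV (u1 j)"
    and cu2: "\<And>j. continuous_on UNIV (u2 j)"
    and harm: "\<And>x. norm x < R \<Longrightarrow> (\<Sum>j\<in>UNIV. u2 j x) = 0"
    and zero: "\<And>x. norm x < r \<Longrightarrow> u x = 0"
    and r: "0 < r" and x: "norm x < R"
  shows "u x = 0"
proof -
  have R: "0 < R" using x norm_ge_zero[of x] by linarith
  let ?K = "cbox (\<chi> i. - R) (\<chi> i. R) :: (real^'n) set"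
  have "(norm x)\<^sup>2 < R\<^sup>2" using x by (intro power_strict_mono) auto
  \<comment> \<open>The bump must be positive at \<open>x\<close> and yet supported inside the ball
    where \<open>u\<close> is harmonic; its exponent 2 is the least that the moment lemma
    admits.\<close>
  then obtain \<rho> where \<rho>: "(norm x)\<^sup>2 < \<rho>" "\<rho> < R\<^sup>2" using dense by blast
  let ?b = "bump \<rho> 2 :: real^'n \<Rightarrow> real"
  have b: "?b y \<ge> 0" for y unfolding bump_def by simp
  have cu': "continuous_on S u" for S using cu continuous_on_subset by blast
  have int: "(\<lambda>y. u y * (f y * ?b y)) integrable_on ?K" if "continuous_on ?K f" for f
    by (intro integrable_continuous continuous_intros cu' that)
  have span: "continuous_on UNIV p \<and> integral ?K (\<lambda>y. u y * (p y * ?b y)) = 0" if "monomial_span p" for p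
    using that
  proof induction
    case (monomial c e)
    have "integral ?K (\<lambda>y. u y * (monomial e y * ?b y)) = 0"
      by (rule harmonic_moment_eq_0[OF p1 p2 cu cu1 cu2 harm zero r R order_refl order_refl \<rho>(2)])
    then have "integral ?K (\<lambda>y. c * (u y * (monomial e y * ?b y))) = 0" by simp
    then show ?case by (auto simp: algebra_simps intro!: continuous_intros)
  next
    case (add f g)
    then have "continuous_on ?K f" "continuous_on ?K g"
      using continuous_on_subset by blast+
    from integral_add[OF int[OF this(1)] int[OF this(2)]] add.IH
    show ?case by (auto simp: algebra_simps intro!: continuous_intros)
  qed
  define A where "A = integral ?K (\<lambda>y. u y * (u y * ?b y))"
  define C where "C = integral ?K (\<lambda>y. \<bar>u y\<bar> * ?b y)"
  have iC: "(\<lambda>y. \<bar>u y\<bar> * ?b y) integrable_on ?K"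
    by (intro integrable_continuous continuous_intros cu')
  have C: "C \<ge> 0" unfolding C_def using b by (intro integral_nonneg iC) auto
  have le: "A \<le> \<epsilon> * C" if \<epsilon>: "\<epsilon> > 0" for \<epsilon>
  proof -
    obtain p where p: "real_polynomial_function p" "\<And>y. y \<in> ?K \<Longrightarrow> \<bar>u y - p y\<bar> < \<epsilon>"
      using Stone_Weierstrass_real_polynomial_function[OF compact_cbox cu' \<epsilon>] by blast
    from span[OF monomial_span_real_polynomial_function[OF p(1)]]
    have cp: "continuous_on ?K p" and p0: "integral ?K (\<lambda>y. u y * (p y * ?b y)) = 0"
      using continuous_on_subset by blast+
    have "A = integral ?K (\<lambda>y. u y * (u y * ?b y) - u y * (p y * ?b y))"
      unfolding A_def using integral_diff[OF int[OF cu'] int[OF cp]] p0 by simp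
    also have "\<dots> \<le> integral ?K (\<lambda>y. \<epsilon> * (\<bar>u y\<bar> * ?b y))"
    proof (rule integral_le)
      show "(\<lambda>y. u y * (u y * ?b y) - u y * (p y * ?b y)) integrable_on ?K"
        by (intro integrable_diff int cu' cp)
      show "(\<lambda>y. \<epsilon> * (\<bar>u y\<bar> * ?b y)) integrable_on ?K"
        by (intro integrable_on_mult_right iC)
      fix y assume "y \<in> ?K"
      have "u y * (u y - p y) \<le> \<bar>u y\<bar> * \<bar>u y - p y\<bar>" by (metis abs_ge_self abs_mult)
      also have "\<dots> \<le> \<bar>u y\<bar> * \<epsilon>" using p(2)[OF \<open>y \<in> ?K\<close>] by (intro mult_left_mono) auto
      finally have "u y * (u y - p y) * ?b y \<le> \<bar>u y\<bar> * \<epsilon> * ?b y" by (rule mult_right_mono) (rule b)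
      then show "u y * (u y * ?b y) - u y * (p y * ?b y) \<le> \<epsilon> * (\<bar>u y\<bar> * ?b y)"
        by (simp add: algebra_simps)
    qed
    finally show ?thesis by (simp add: C_def)
  qed
  have "A \<le> 0"
  proof (rule ccontr)
    assume "\<not> A \<le> 0"
    \<comment> \<open>Taking this as \<epsilon> gives A \<le> A C / (C + 1) < A; the 1 guards
      against \<open>C = 0\<close>.\<close>
    then have "A / (C + 1) > 0" using C by simp
    from le[OF this] \<open>\<not> A \<le> 0\<close> C show False by (simp add: field_simps)
  qed
  moreover have "A \<ge> 0"
    unfolding A_def by (intro integral_nonneg int cu') (use b in \<open>auto simp flip: mult.assoc\<close>)
  ultimately have "A = 0" by simp
  have "(\<forall>y\<in>?K. u y * (u y * ?b y) = 0)"
  proof (subst integral_cbox_eq_0_iff[symmetric])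
    show "box (\<chi> i. - R) (\<chi> i. R) \<noteq> ({} :: (real^'n) set)"
      using R by (auto simp: interval_eq_empty_cart)
    show "0 \<le> u y * (u y * ?b y)" for y using b[of y] by (simp flip: mult.assoc)
    show "integral ?K (\<lambda>y. u y * (u y * ?b y)) = 0" using \<open>A = 0\<close> by (simp only: A_def)
  qed (intro continuous_intros cu')
  moreover have "x \<in> ?K" using x by (intro cube_supset_ball) simp
  moreover have "?b x > 0" using \<rho> unfolding bump_def by simp
  ultimately show ?thesis by force
qed

subsection \<open>A maximum principle for periodic transport inequalities\<close>

text \<open>Exchange of derivatives when only one mixed derivative is known to exist: write
  \<open>v\<close> as its value at a base time plus the integral of \<open>w\<close>, differentiate
  in x under the integral, and apply the fundamental theorem in t. It serves for the second
  derivatives of \<open>V\<close>, for the time derivative of \<open>DV\<close>, and for the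
  pressure.\<close>

lemma has_real_derivative_mixed:
  fixes v p w q :: "real \<Rightarrow> real \<Rightarrow> real"
  assumes vx: "\<And>x t. ((\<lambda>x. v x t) has_real_derivative p x t) (at x)"
    and vt: "\<And>x t. ((\<lambda>t. v x t) has_real_derivative w x t) (at t)"
    and wx: "\<And>x t. ((\<lambda>x. w x t) has_real_derivative q x t) (at x)"
    and cq: "continuous_on UNIV (\<lambda>(x, t). q x t)"
  shows "((\<lambda>t. p x t) has_real_derivative q x t) (at t)"
proof -
  define a b where "a = t - 1" and "b = t + 1"
  have ab: "a < t" "t < b" by (auto simp: a_def b_def)
  have cqx: "continuous_on A (q x)" for A
    by (rule continuous_on_compose2[OF cq, of _ "\<lambda>t. (x, t)", simplified]) (auto intro!: continuous_intros)
  have int: "(w x has_integral v x t' - v x a) (cbox a t')" if "a \<le> t'" for x t'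
    using fundamental_theorem_of_calculus[OF that, of "v x" "w x"] vt
    by (simp add: has_real_derivative_iff_has_vector_derivative has_vector_derivative_at_within)
  have p: "p x t' = p x a + integral {a..t'} (q x)" if "a \<le> t'" for t'
  proof -
    have "((\<lambda>x. integral (cbox a t') (w x)) has_field_derivative integral (cbox a t') (q x)) (at x within UNIV)"
      by (rule leibniz_rule_field_derivative)
        (use int[OF that] wx cq in \<open>auto intro: continuous_on_subset simp: integrable_on_def\<close>)
    moreover have "(\<lambda>x. integral (cbox a t') (w x)) = (\<lambda>x. v x t' - v x a)"
      using int[OF that] by (auto intro!: integral_unique)
    moreover have "((\<lambda>x. v x t' - v x a) has_real_derivative p x t' - p x a) (at x)"
      by (intro DERIV_diff vx)
    ultimately have "p x t' - p x a = integral (cbox a t') (q x)"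
      using DERIV_unique by metis
    then show ?thesis by simp
  qed
  have "((\<lambda>t'. integral {a..t'} (q x)) has_real_derivative q x t) (at t within {a..b})"
    by (rule integral_has_real_derivative) (use ab cqx in auto)
  then have "((\<lambda>t'. integral {a..t'} (q x)) has_real_derivative q x t) (at t)"
    using ab at_within_Icc_at[of a t b] by simp
  then have "((\<lambda>t'. p x a + integral {a..t'} (q x)) has_real_derivative q x t) (at t)"
    by (auto intro!: derivative_eq_intros)
  then show ?thesis
    by (rule has_field_derivative_transform_within_open[of _ _ _ "{a<..}"])
      (use ab in \<open>auto intro: p[symmetric]\<close>)
qed

lemma has_vector_derivative_line:
  assumes "\<And>z. (F has_derivative F' z) (at z)"
  shows "((\<lambda>x. F (y + x *\<^sub>R h)) has_vector_derivative F' (y + x *\<^sub>R h) h) (at x)"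
proof -
  have "((\<lambda>x. y + x *\<^sub>R h) has_derivative (\<lambda>x. x *\<^sub>R h)) (at x)"
    by (auto intro!: derivative_eq_intros)
  then have "((\<lambda>x. F (y + x *\<^sub>R h)) has_derivative (\<lambda>t. F' (y + x *\<^sub>R h) (t *\<^sub>R h))) (at x)"
    by (rule has_derivative_compose) (rule assms)
  moreover have "F' (y + x *\<^sub>R h) (t *\<^sub>R h) = t *\<^sub>R F' (y + x *\<^sub>R h) h" for t
    by (rule linear_cmul[OF has_derivative_linear[OF assms]])
  ultimately show ?thesis
    unfolding has_vector_derivative_def by (simp only:)
qed

lemma has_real_derivative_line:
  fixes F :: "'a::real_normed_vector \<Rightarrow> real"
  assumes "\<And>z. (F has_derivative F' z) (at z)"
  shows "((\<lambda>x. F (y + x *\<^sub>R h)) has_real_derivative F' (y + x *\<^sub>R h) h) (at x)"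
  using has_vector_derivative_line[OF assms]
  by (simp add: has_real_derivative_iff_has_vector_derivative)

lemma has_partial_of_has_derivative:
  assumes "\<And>z. (F has_derivative F' z) (at z)"
  shows "has_partial j F (\<lambda>z. F' z (axis j 1))"
  unfolding has_partial_def using has_real_derivative_line[OF assms, where x = 0] by simp

text \<open>This reduces suprema over all times to a compact interval. The value type is arbitrary,
  so that a pair such as \<open>(V y s, DV y s)\<close> gets one common representative.\<close>

lemma periodic_representative:
  fixes S :: real
  assumes "S > 0" and "\<And>s. f (s + S) = f s"
  obtains s' where "s' \<in> {0..S}" "f s = f s'"
proof -
  interpret periodic_fun_simple f S by standard (rule assms(2))
  let ?n = "\<lfloor>s / S\<rfloor>"
  have "of_int ?n * S \<le> s" "s < (of_int ?n + 1) * S"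
    using floor_divide_lower[OF assms(1)] floor_divide_upper[OF assms(1)] by auto
  then have "s - of_int ?n * S \<in> {0..S}" by (auto simp: algebra_simps)
  moreover have "f s = f (s - of_int ?n * S)" by (simp add: minus_of_int)
  ultimately show ?thesis using that by blast
qed

text \<open>At a maximum of \<open>f y s * exp (- k |y|\<^sup>2)\<close> over a closed ball and all times, the time
  derivative vanishes and moving against the outward field \<open>b\<close> stays in the ball, so the derivative
  along \<open>b\<close> is nonnegative; for large \<open>k\<close> this forces \<open>f = 0\<close> there.\<close>

lemma periodic_transport_vanishing:
  fixes f ft :: "'a::euclidean_space \<Rightarrow> real \<Rightarrow> real" and f' :: "'a \<Rightarrow> real \<Rightarrow> 'a \<Rightarrow> real"
  assumes S: "S > 0" and per: "\<And>y s. f y (s + S) = f y s"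
    and cont: "continuous_on UNIV (\<lambda>(y, s). f y s)"
    and ft: "\<And>y s. ((\<lambda>t. f y t) has_real_derivative ft y s) (at s)"
    and f': "\<And>y s. ((\<lambda>z. f z s) has_derivative f' y s) (at y)"
    and nonneg: "\<And>y s. f y s \<ge> 0"
    and zero: "\<And>y s. norm y < r \<Longrightarrow> f y s = 0"
    and out: "\<And>y s. \<lbrakk>r \<le> norm y; norm y \<le> R\<rbrakk> \<Longrightarrow> \<kappa> \<le> b y s \<bullet> y" and \<kappa>: "\<kappa> > 0"
    and ineq: "\<And>y s. \<lbrakk>norm y \<le> R; ft y s = 0\<rbrakk> \<Longrightarrow> f' y s (b y s) \<le> C * f y s"
    and y1: "norm y1 \<le> R"
  shows "f y1 s1 = 0"
proof (rule ccontr)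
  assume "f y1 s1 \<noteq> 0"
  with nonneg[of y1 s1] have pos1: "f y1 s1 > 0" by linarith
  \<comment> \<open>The weight then contributes at least 2 k \<kappa> = |C| + 1 along
    \<open>b\<close>, which beats the growth rate \<open>C\<close>; the 1 also keeps
    \<open>k\<close> positive.\<close>
  define k where "k = (\<bar>C\<bar> + 1) / (2 * \<kappa>)"
  have "2 * k * \<kappa> = \<bar>C\<bar> + 1" using \<kappa> by (simp add: k_def)
  then have k: "k > 0" "2 * k * \<kappa> > C" using \<kappa> by (auto simp: k_def)
  define g where "g y s = f y s * exp (- k * (norm y)\<^sup>2)" for y s
  have "continuous_on (cball 0 R \<times> {0..S}) (\<lambda>p. f (fst p) (snd p))"
    using cont by (auto simp: split_beta intro: continuous_on_subset)
  then have cg: "continuous_on (cball 0 R \<times> {0..S}) (\<lambda>p. g (fst p) (snd p))"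
    unfolding g_def by (intro continuous_intros)
  have "compact (cball (0::'a) R \<times> {0..S})" by (intro compact_Times) auto
  moreover have "cball (0::'a) R \<times> {0..S} \<noteq> {}" using order_trans[OF norm_ge_zero y1] S by auto
  ultimately obtain p where p: "p \<in> cball 0 R \<times> {0..S}"
    "\<And>p'. p' \<in> cball 0 R \<times> {0..S} \<Longrightarrow> g (fst p') (snd p') \<le> g (fst p) (snd p)"
    using continuous_attains_sup[OF _ _ cg] by blast
  define y0 s0 where "y0 = fst p" and "s0 = snd p"
  have y0: "norm y0 \<le> R" using p(1) by (auto simp: y0_def mem_Times_iff)
  have max: "g y s \<le> g y0 s0" if y: "norm y \<le> R" for y s
  proof -
    obtain s' where s': "s' \<in> {0..S}" "f y s = f y s'"
      using periodic_representative[OF S, of "f y" s] per by metis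
    with p(2)[of "(y, s')"] y show ?thesis by (simp add: g_def y0_def s0_def)
  qed
  have "0 < g y1 s1" using pos1 by (simp add: g_def)
  also have "\<dots> \<le> g y0 s0" by (rule max[OF y1])
  finally have pos: "f y0 s0 > 0" by (simp add: g_def zero_less_mult_iff)
  then have r: "r \<le> norm y0" using zero[of y0 s0] by force
  \<comment> \<open>The weight does not depend on time, and by periodicity the maximum is over the
    whole time line, so it has no endpoint at which the derivative could survive.\<close>
  have ft0: "ft y0 s0 = 0"
  proof (rule DERIV_local_max[OF ft[of y0 s0] zero_less_one], intro allI impI)
    fix s show "f y0 s \<le> f y0 s0" using max[OF y0, of s] by (simp add: g_def)
  qed
  let ?b = "b y0 s0"
  have b: "?b \<bullet> y0 \<ge> \<kappa>" by (rule out[OF r y0])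
  have sq: "(norm (y0 + t *\<^sub>R (- ?b)))\<^sup>2 = (norm y0)\<^sup>2 - 2 * t * (?b \<bullet> y0) + t\<^sup>2 * (norm ?b)\<^sup>2" for t
    unfolding power2_norm_eq_inner
    by (simp add: inner_diff inner_commute power2_eq_square algebra_simps)
  define \<psi> where "\<psi> t = g (y0 + t *\<^sub>R (- ?b)) s0" for t
  have lin: "f' y0 s0 (- ?b) = - f' y0 s0 ?b"
    by (rule linear_neg[OF has_derivative_linear[OF f']])
  have df: "((\<lambda>t. f (y0 + t *\<^sub>R (- ?b)) s0) has_real_derivative - f' y0 s0 ?b) (at 0)"
    using has_real_derivative_line[of "\<lambda>z. f z s0" "\<lambda>z. f' z s0" y0 "- ?b" 0] f' lin by simp
  have de: "((\<lambda>t. exp (- k * (norm (y0 + t *\<^sub>R (- ?b)))\<^sup>2)) has_real_derivative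
      exp (- k * (norm y0)\<^sup>2) * (2 * k * (?b \<bullet> y0))) (at 0)"
    unfolding sq by (auto intro!: derivative_eq_intros)
  have d\<psi>: "(\<psi> has_real_derivative exp (- k * (norm y0)\<^sup>2) * (2 * k * (?b \<bullet> y0) * f y0 s0 - f' y0 s0 ?b)) (at 0)"
    unfolding \<psi>_def g_def using DERIV_mult[OF df de] by (simp add: algebra_simps)
  have "f' y0 s0 ?b < 2 * k * (?b \<bullet> y0) * f y0 s0"
  proof -
    have "f' y0 s0 ?b \<le> C * f y0 s0" by (rule ineq[OF y0 ft0])
    also have "\<dots> < 2 * k * \<kappa> * f y0 s0" using k(2) pos by (rule mult_strict_right_mono)
    also have "\<dots> \<le> 2 * k * (?b \<bullet> y0) * f y0 s0" using b k pos by (intro mult_right_mono) auto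
    finally show ?thesis .
  qed
  then have "0 < exp (- k * (norm y0)\<^sup>2) * (2 * k * (?b \<bullet> y0) * f y0 s0 - f' y0 s0 ?b)"
    by simp
  from DERIV_pos_inc_right[OF d\<psi> this]
  obtain d where d: "d > 0" "\<And>h. \<lbrakk>0 < h; h < d\<rbrakk> \<Longrightarrow> \<psi> 0 < \<psi> h"
    by auto
  \<comment> \<open>The first entry keeps the step in the range where \<psi> increases. The second
    ensures h |b|^2 \<le> 2 \<kappa>, which is what makes |y0 - h b| \<le> |y0|; the 1 avoids a zero
    denominator.\<close>
  define h where "h = min (d / 2) (2 * \<kappa> / ((norm ?b)\<^sup>2 + 1))"
  have den: "(norm ?b)\<^sup>2 + 1 > 0" by (simp add: add_nonneg_pos)
  have h: "0 < h" "h < d" using d(1) \<kappa> den by (auto simp: h_def)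
  have "h * (norm ?b)\<^sup>2 \<le> h * ((norm ?b)\<^sup>2 + 1)" using h by simp
  also have "\<dots> \<le> 2 * \<kappa>" using den by (simp add: h_def flip: pos_le_divide_eq)
  also have "\<dots> \<le> 2 * (?b \<bullet> y0)" using b by simp
  finally have "h * (h * (norm ?b)\<^sup>2) \<le> h * (2 * (?b \<bullet> y0))" using h by simp
  then have "(norm (y0 + h *\<^sub>R (- ?b)))\<^sup>2 \<le> (norm y0)\<^sup>2"
    unfolding sq by (simp add: power2_eq_square algebra_simps)
  then have "norm (y0 + h *\<^sub>R (- ?b)) \<le> norm y0" by (rule power2_le_imp_le) simp
  then have "\<psi> h \<le> \<psi> 0" using max y0 unfolding \<psi>_def by simp
  with d(2)[OF h] show False by simp
qed

subsection \<open>Vorticity of periodic solutions\<close>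

text \<open>Here \<open>a\<close> and \<open>c\<close> stand for \<alpha>/(\<alpha> + 1) and
  1/(\<alpha> + 1); the sign of \<open>c\<close> is left open. The momentum equation is stated as a
  formula for the partial derivatives of \<open>P\<close>, the form in which the pressure is later
  eliminated by differentiating that formula once more.\<close>

locale periodic_euler =
  fixes a c S :: real
    and V W :: "real^'n::finite \<Rightarrow> real \<Rightarrow> real^'n"
    and DV DW :: "real^'n \<Rightarrow> real \<Rightarrow> (real^'n) \<Rightarrow>\<^sub>L (real^'n)"
    and D2V :: "real^'n \<Rightarrow> real \<Rightarrow> (real^'n) \<Rightarrow>\<^sub>L ((real^'n) \<Rightarrow>\<^sub>L (real^'n))"
    and P :: "real^'n \<Rightarrow> real \<Rightarrow> real"
  assumes DV: "\<And>y s. ((\<lambda>z. V z s) has_derivative DV y s) (at y)"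
    and D2V: "\<And>y s. ((\<lambda>z. DV z s) has_derivative D2V y s) (at y)"
    and W: "\<And>y s. ((\<lambda>t. V y t) has_vector_derivative W y s) (at s)"
    and DW: "\<And>y s. ((\<lambda>z. W z s) has_derivative DW y s) (at y)"
    and cont_V: "continuous_on UNIV (\<lambda>(y, s). V y s)"
    and cont_DV: "continuous_on UNIV (\<lambda>(y, s). DV y s)"
    and cont_D2V: "continuous_on UNIV (\<lambda>(y, s). D2V y s)"
    and cont_DW: "continuous_on UNIV (\<lambda>(y, s). DW y s)"
    and momentum: "\<And>j s. has_partial j (\<lambda>y. P y s)
          (\<lambda>y. - (W y s + a *\<^sub>R V y s + DV y s (c *\<^sub>R y + V y s)) $ j)"
    and div_free: "\<And>y s. (\<Sum>j\<in>UNIV. DV y s (axis j 1) $ j) = 0"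
    and coeffs: "a + c = 1" "c \<noteq> 0"
    and S: "S > 0" and periodic: "\<And>y s. V y (s + S) = V y s"
begin

text \<open>Joint continuity is recast for curried functions, so that continuity of composite
  expressions can be decomposed automatically.\<close>

lemmas continuous_compose [continuous_intros] =
  continuous_on_compose2[OF cont_V, of _ "\<lambda>x. (f x, g x)" for f g, simplified]
  continuous_on_compose2[OF cont_DV, of _ "\<lambda>x. (f x, g x)" for f g, simplified]
  continuous_on_compose2[OF cont_D2V, of _ "\<lambda>x. (f x, g x)" for f g, simplified]
  continuous_on_compose2[OF cont_DW, of _ "\<lambda>x. (f x, g x)" for f g, simplified]

lemma DV_component: "((\<lambda>z. V z s $ k) has_derivative (\<lambda>h. DV y s h $ k)) (at y)"
  by (rule bounded_linear.has_derivative[OF bounded_linear_vec_nth DV])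

lemma DW_component: "((\<lambda>z. W z s $ k) has_derivative (\<lambda>h. DW y s h $ k)) (at y)"
  by (rule bounded_linear.has_derivative[OF bounded_linear_vec_nth DW])

lemma W_component: "((\<lambda>t. V y t $ k) has_real_derivative W y s $ k) (at s)"
  unfolding has_real_derivative_iff_has_vector_derivative
  by (rule bounded_linear.has_vector_derivative[OF bounded_linear_vec_nth W])

lemma D2V_apply: "((\<lambda>z. DV z s h) has_derivative (\<lambda>h'. D2V y s h' h)) (at y)"
  by (rule bounded_linear.has_derivative[OF blinfun.bounded_linear_left D2V])

lemma D2V_component: "((\<lambda>z. DV z s h $ k) has_derivative (\<lambda>h'. D2V y s h' h $ k)) (at y)"
  by (rule bounded_linear.has_derivative[OF bounded_linear_vec_nth D2V_apply])

lemma D2V_symmetric: "D2V y s h h' = D2V y s h' h"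
proof (rule vec_eq_iff[THEN iffD2], rule allI)
  fix k
  let ?z = "\<lambda>x t. y + x *\<^sub>R h + t *\<^sub>R h'"
  have swap: "?z x t = y + t *\<^sub>R h' + x *\<^sub>R h" for x t
    by (simp add: algebra_simps)
  have "((\<lambda>t. DV (?z 0 t) s h $ k) has_real_derivative D2V (?z 0 0) s h h' $ k) (at 0)"
  proof (rule has_real_derivative_mixed[where v = "\<lambda>x t. V (?z x t) s $ k"
        and p = "\<lambda>x t. DV (?z x t) s h $ k" and w = "\<lambda>x t. DV (?z x t) s h' $ k"
        and q = "\<lambda>x t. D2V (?z x t) s h h' $ k"])
    show "((\<lambda>x. V (?z x t) s $ k) has_real_derivative DV (?z x t) s h $ k) (at x)" for x t
      unfolding swap by (rule has_real_derivative_line[OF DV_component])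
    show "((\<lambda>t. V (?z x t) s $ k) has_real_derivative DV (?z x t) s h' $ k) (at t)" for x t
      by (rule has_real_derivative_line[OF DV_component])
    show "((\<lambda>x. DV (?z x t) s h' $ k) has_real_derivative D2V (?z x t) s h h' $ k) (at x)" for x t
      unfolding swap by (rule has_real_derivative_line[OF D2V_component])
    show "continuous_on UNIV (\<lambda>(x, t). D2V (?z x t) s h h' $ k)"
      unfolding split_beta by (intro continuous_intros)
  qed
  moreover have "((\<lambda>t. DV (y + t *\<^sub>R h') s h $ k) has_real_derivative
      D2V (y + 0 *\<^sub>R h') s h' h $ k) (at 0)"
    by (rule has_real_derivative_line[OF D2V_component])
  ultimately show "D2V y s h h' $ k = D2V y s h' h $ k"
    by (simp add: DERIV_unique)
qed

text \<open>The hypotheses give the space derivative of the time derivative; the opposite order,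
  needed to differentiate the vorticity in time, follows from continuity of
  \<open>DW\<close>.\<close>

lemma DW_component_time: "((\<lambda>t. DV y t h $ k) has_real_derivative DW y s h $ k) (at s)"
proof -
  have "((\<lambda>t. DV (y + 0 *\<^sub>R h) t h $ k) has_real_derivative DW (y + 0 *\<^sub>R h) s h $ k) (at s)"
  proof (rule has_real_derivative_mixed[where v = "\<lambda>x t. V (y + x *\<^sub>R h) t $ k"
        and p = "\<lambda>x t. DV (y + x *\<^sub>R h) t h $ k" and w = "\<lambda>x t. W (y + x *\<^sub>R h) t $ k"
        and q = "\<lambda>x t. DW (y + x *\<^sub>R h) t h $ k"])
    show "((\<lambda>x. V (y + x *\<^sub>R h) t $ k) has_real_derivative DV (y + x *\<^sub>R h) t h $ k) (at x)" for x t
      by (rule has_real_derivative_line[OF DV_component])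
    show "((\<lambda>x. W (y + x *\<^sub>R h) t $ k) has_real_derivative DW (y + x *\<^sub>R h) t h $ k) (at x)" for x t
      by (rule has_real_derivative_line[OF DW_component])
    show "((\<lambda>t. V (y + x *\<^sub>R h) t $ k) has_real_derivative W (y + x *\<^sub>R h) t $ k) (at t)" for x t
      by (rule W_component)
    show "continuous_on UNIV (\<lambda>(x, t). DW (y + x *\<^sub>R h) t h $ k)"
      unfolding split_beta by (intro continuous_intros)
  qed
  then show ?thesis by simp
qed

definition force_deriv :: "real^'n \<Rightarrow> real \<Rightarrow> real^'n \<Rightarrow> real^'n" where
  "force_deriv y s h = DW y s h + a *\<^sub>R DV y s h + D2V y s h (c *\<^sub>R y + V y s)
     + DV y s (c *\<^sub>R h + DV y s h)"

lemma force_has_derivative: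
  "((\<lambda>z. W z s + a *\<^sub>R V z s + DV z s (c *\<^sub>R z + V z s)) has_derivative force_deriv y s) (at y)"
proof -
  have "((\<lambda>z. c *\<^sub>R z + V z s) has_derivative (\<lambda>h. c *\<^sub>R h + DV y s h)) (at y)"
    by (intro has_derivative_add has_derivative_scaleR_right has_derivative_ident DV)
  from bounded_bilinear.FDERIV[OF bounded_bilinear_blinfun_apply D2V this]
  have "((\<lambda>z. DV z s (c *\<^sub>R z + V z s)) has_derivative
      (\<lambda>h. DV y s (c *\<^sub>R h + DV y s h) + D2V y s h (c *\<^sub>R y + V y s))) (at y)" .
  from has_derivative_add[OF has_derivative_add[OF DW has_derivative_scaleR_right[OF DV]] this]
  show ?thesis by (simp add: force_deriv_def[abs_def] algebra_simps)
qed

text \<open>This is the elimination of the pressure: up to sign, both sides are mixed second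
  derivatives of \<open>P\<close>. Those exist because the first ones are given by a differentiable
  expression with continuous derivative.\<close>

lemma force_deriv_symmetric: "force_deriv y s (axis i 1) $ j = force_deriv y s (axis j 1) $ i"
proof -
  let ?A = "\<lambda>y. W y s + a *\<^sub>R V y s + DV y s (c *\<^sub>R y + V y s)"
  have A: "((\<lambda>z. - ?A z $ k) has_derivative (\<lambda>h. - force_deriv z s h $ k)) (at z)" for z k
    by (intro has_derivative_minus bounded_linear.has_derivative[OF bounded_linear_vec_nth]
        force_has_derivative)
  have P: "((\<lambda>t. P (y + t *\<^sub>R axis k 1) s) has_real_derivative - ?A (y + t *\<^sub>R axis k 1) $ k) (at t)"
    for y t k by (rule has_partialD_at[OF momentum])
  let ?z = "\<lambda>x t. y + x *\<^sub>R axis i 1 + t *\<^sub>R axis j 1 :: real^'n"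
  have "((\<lambda>t. - ?A (?z 0 t) $ i) has_real_derivative - force_deriv (?z 0 0) s (axis i 1) $ j) (at 0)"
  proof (rule has_real_derivative_mixed[where v = "\<lambda>x t. P (?z x t) s"
        and p = "\<lambda>x t. - ?A (?z x t) $ i" and w = "\<lambda>x t. - ?A (?z x t) $ j"
        and q = "\<lambda>x t. - force_deriv (?z x t) s (axis i 1) $ j"])
    show "((\<lambda>t. P (?z x t) s) has_real_derivative - ?A (?z x t) $ j) (at t)" for x t
      by (rule P)
    have swap: "?z x t = y + t *\<^sub>R axis j 1 + x *\<^sub>R axis i 1" for x t
      by (simp add: algebra_simps)
    show "((\<lambda>x. P (?z x t) s) has_real_derivative - ?A (?z x t) $ i) (at x)" for x t
      unfolding swap by (rule P)
    show "((\<lambda>x. - ?A (?z x t) $ j) has_real_derivative - force_deriv (?z x t) s (axis i 1) $ j) (at x)"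
      for x t
      unfolding swap by (rule has_real_derivative_line[OF A])
    show "continuous_on UNIV (\<lambda>(x, t). - force_deriv (?z x t) s (axis i 1) $ j)"
      unfolding split_beta force_deriv_def by (intro continuous_intros)
  qed
  moreover have "((\<lambda>t. - ?A (y + t *\<^sub>R axis j 1) $ i) has_real_derivative
      - force_deriv (y + 0 *\<^sub>R axis j 1) s (axis j 1) $ i) (at 0)"
    by (rule has_real_derivative_line[OF A])
  ultimately show ?thesis
    using DERIV_unique by fastforce
qed

text \<open>The curl in matrix form, the difference of the i-th derivative of component j and the
  j-th derivative of component i, meaningful in every dimension.\<close>

definition vort :: "'n \<Rightarrow> 'n \<Rightarrow> real^'n \<Rightarrow> real \<Rightarrow> real" where
  "vort i j y s = DV y s (axis i 1) $ j - DV y s (axis j 1) $ i"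

lemma vort_has_derivative:
  "((\<lambda>z. vort i j z s) has_derivative (\<lambda>h. D2V y s h (axis i 1) $ j - D2V y s h (axis j 1) $ i)) (at y)"
  unfolding vort_def by (intro has_derivative_diff D2V_component)

lemma vort_has_time_derivative:
  "((\<lambda>t. vort i j y t) has_real_derivative DW y s (axis i 1) $ j - DW y s (axis j 1) $ i) (at s)"
  unfolding vort_def by (intro DERIV_diff DW_component_time)

text \<open>Antisymmetrize the derivative of the momentum expression. The coefficient of
  \<open>vort\<close> is -(a + c) = -1, where \<open>c\<close> arises from differentiating the
  factor y in the drift.\<close>

lemma vorticity_equation:
  "(DW y s (axis i 1) $ j - DW y s (axis j 1) $ i)
    + (D2V y s (c *\<^sub>R y + V y s) (axis i 1) $ j - D2V y s (c *\<^sub>R y + V y s) (axis j 1) $ i)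
   = - vort i j y s - (\<Sum>k\<in>UNIV. DV y s (axis i 1) $ k * vort k j y s - DV y s (axis j 1) $ k * vort k i y s)"
proof -
  let ?d = "\<lambda>i j. DV y s (axis i 1) $ j" and ?b = "c *\<^sub>R y + V y s"
  have exp: "DV y s (DV y s (axis i 1)) $ j = (\<Sum>k\<in>UNIV. ?d i k * ?d k j)" for i j
    by (subst linear_vec_expansion[OF bounded_linear.linear[OF blinfun.bounded_linear_right]]) simp
  have fd: "force_deriv y s (axis i 1) $ j =
      DW y s (axis i 1) $ j + D2V y s ?b (axis i 1) $ j + ?d i j + (\<Sum>k\<in>UNIV. ?d i k * ?d k j)" for i j
  proof -
    have "DV y s (c *\<^sub>R axis i 1 + DV y s (axis i 1)) $ j = c * ?d i j + (\<Sum>k\<in>UNIV. ?d i k * ?d k j)"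
      by (simp add: blinfun.add_right blinfun.scaleR_right exp)
    moreover have "a * ?d i j + c * ?d i j = ?d i j"
      using coeffs(1) by (simp flip: distrib_right)
    ultimately show ?thesis
      unfolding force_deriv_def D2V_symmetric[of y s _ ?b] by simp
  qed
  \<comment> \<open>Expanding \<open>vort\<close> creates the products
    \<open>?d i k * ?d j k\<close> twice with opposite signs. Thus the quadratic terms are linear in
    the vorticity with coefficients from \<open>DV\<close>.\<close>
  have "(\<Sum>k\<in>UNIV. ?d i k * vort k j y s - ?d j k * vort k i y s)
    = (\<Sum>k\<in>UNIV. ?d i k * ?d k j) - (\<Sum>k\<in>UNIV. ?d j k * ?d k i)"
    unfolding sum_subtractf[symmetric] by (rule sum.cong) (auto simp: vort_def algebra_simps)
  then show ?thesis
    using force_deriv_symmetric[of y s i j] unfolding fd by (simp add: vort_def)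
qed

lemma DV_periodic: "DV y (s + S) = DV y s"
proof -
  have "((\<lambda>z. V z s) has_derivative DV y (s + S)) (at y)"
    using DV[where y = y and s = "s + S"] by (simp add: periodic)
  from has_derivative_unique[OF this DV] show ?thesis
    by (simp add: blinfun_apply_inject)
qed

text \<open>One nonnegative differentiable scalar whose zeros are the common zeros of all
  \<open>vort i j\<close>, so that a scalar maximum principle suffices.\<close>

definition enstrophy :: "real^'n \<Rightarrow> real \<Rightarrow> real" where
  "enstrophy y s = (\<Sum>i\<in>UNIV. \<Sum>j\<in>UNIV. (vort i j y s)\<^sup>2)"

lemma enstrophy_nonneg: "0 \<le> enstrophy y s"
  unfolding enstrophy_def by (intro sum_nonneg) simp

lemma vort_square_le_enstrophy: "(vort i j y s)\<^sup>2 \<le> enstrophy y s"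
proof -
  have "(vort i j y s)\<^sup>2 \<le> (\<Sum>j\<in>UNIV. (vort i j y s)\<^sup>2)"
    by (rule member_le_sum) auto
  also have "\<dots> \<le> enstrophy y s"
    unfolding enstrophy_def
    by (rule member_le_sum[where f = "\<lambda>i. \<Sum>j\<in>UNIV. (vort i j y s)\<^sup>2"]) (auto intro: sum_nonneg)
  finally show ?thesis .
qed

lemma vort_mult_le_enstrophy: "\<bar>vort i j y s\<bar> * \<bar>vort k l y s\<bar> \<le> enstrophy y s"
  using sum_squares_bound[of "\<bar>vort i j y s\<bar>" "\<bar>vort k l y s\<bar>"]
    vort_square_le_enstrophy[of i j y s] vort_square_le_enstrophy[of k l y s] by simp

lemma enstrophy_has_derivative:
  "((\<lambda>z. enstrophy z s) has_derivative (\<lambda>h. \<Sum>i\<in>UNIV. \<Sum>j\<in>UNIV.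
     2 * vort i j y s * (D2V y s h (axis i 1) $ j - D2V y s h (axis j 1) $ i))) (at y)"
proof -
  have "((\<lambda>z. (vort i j z s)\<^sup>2) has_derivative
     (\<lambda>h. 2 * vort i j y s * (D2V y s h (axis i 1) $ j - D2V y s h (axis j 1) $ i))) (at y)" for i j
    by (rule has_derivative_eq_rhs[OF has_derivative_power[OF vort_has_derivative]])
      (simp add: fun_eq_iff)
  then show ?thesis
    unfolding enstrophy_def by (intro has_derivative_sum)
qed

lemma enstrophy_has_time_derivative:
  "((\<lambda>t. enstrophy y t) has_real_derivative (\<Sum>i\<in>UNIV. \<Sum>j\<in>UNIV.
     2 * vort i j y s * (DW y s (axis i 1) $ j - DW y s (axis j 1) $ i))) (at s)"
proof -
  have "((\<lambda>t. (vort i j y t)\<^sup>2) has_real_derivative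
     2 * vort i j y s * (DW y s (axis i 1) $ j - DW y s (axis j 1) $ i)) (at s)" for i j
    by (rule DERIV_cong[OF DERIV_power[OF vort_has_time_derivative]]) simp
  then show ?thesis
    unfolding enstrophy_def by (intro DERIV_sum)
qed

text \<open>The vorticity equation is linear in \<open>vort\<close>, so the left side is quadratic
  in it. The outer factors \<open>N\<close> count the pairs i, j, the inner one the sum over k with
  two terms each. The bound is two-sided because the field may point inward.\<close>

lemma enstrophy_transport_bound:
  assumes M: "norm (DV y s) \<le> M"
  defines "N \<equiv> real CARD('n)"
  shows "\<bar>(\<Sum>i\<in>UNIV. \<Sum>j\<in>UNIV. 2 * vort i j y s * (DW y s (axis i 1) $ j - DW y s (axis j 1) $ i))
    + (\<Sum>i\<in>UNIV. \<Sum>j\<in>UNIV. 2 * vort i j y s *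
        (D2V y s (c *\<^sub>R y + V y s) (axis i 1) $ j - D2V y s (c *\<^sub>R y + V y s) (axis j 1) $ i))\<bar>
    \<le> N * (N * (2 * (1 + N * (2 * M)))) * enstrophy y s"
proof -
  let ?d = "\<lambda>i j. DV y s (axis i 1) $ j" and ?v = "\<lambda>i j. vort i j y s" and ?E = "enstrophy y s"
  let ?R = "\<lambda>i j. 2 * ?v i j * (- ?v i j - (\<Sum>k\<in>UNIV. ?d i k * ?v k j - ?d j k * ?v k i))"
  have d: "\<bar>?d i k\<bar> \<le> M" for i k
  proof -
    have "\<bar>?d i k\<bar> \<le> norm (DV y s (axis i 1))" by (rule component_le_norm_cart)
    also have "\<dots> \<le> norm (DV y s) * norm (axis i 1 :: real^'n)" by (rule norm_blinfun)
    finally show ?thesis using M by simp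
  qed
  have dv: "\<bar>?v i j * (?d l k * ?v m n)\<bar> \<le> M * ?E" for i j k l m n
  proof -
    have "\<bar>?v i j * (?d l k * ?v m n)\<bar> = \<bar>?d l k\<bar> * (\<bar>?v i j\<bar> * \<bar>?v m n\<bar>)"
      by (simp add: abs_mult)
    also have "\<dots> \<le> M * ?E"
      using d[of l k] by (intro mult_mono vort_mult_le_enstrophy) auto
    finally show ?thesis .
  qed
  have R: "\<bar>?R i j\<bar> \<le> 2 * (1 + N * (2 * M)) * ?E" for i j
  proof -
    have "\<bar>\<Sum>k\<in>UNIV. ?v i j * (?d i k * ?v k j) - ?v i j * (?d j k * ?v k i)\<bar> \<le> (\<Sum>k\<in>(UNIV :: 'n set). 2 * (M * ?E))"
    proof (intro order_trans[OF sum_abs] sum_mono)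
      fix k
      show "\<bar>?v i j * (?d i k * ?v k j) - ?v i j * (?d j k * ?v k i)\<bar> \<le> 2 * (M * ?E)"
        using abs_triangle_ineq4[of "?v i j * (?d i k * ?v k j)" "?v i j * (?d j k * ?v k i)"]
          dv[of i j i k k j] dv[of i j j k k i] by linarith
    qed
    then have "\<bar>\<Sum>k\<in>UNIV. ?v i j * (?d i k * ?v k j) - ?v i j * (?d j k * ?v k i)\<bar> \<le> N * (2 * (M * ?E))"
      by (simp add: N_def)
    moreover have "?R i j = - 2 * (?v i j)\<^sup>2
        - 2 * (\<Sum>k\<in>UNIV. ?v i j * (?d i k * ?v k j) - ?v i j * (?d j k * ?v k i))"
      by (simp add: algebra_simps power2_eq_square sum_distrib_left sum_subtractf)
    ultimately have "\<bar>?R i j\<bar> \<le> 2 * (?v i j)\<^sup>2 + 2 * (N * (2 * (M * ?E)))"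
      by (smt (verit) zero_le_power2)
    also have "\<dots> \<le> 2 * ?E + 2 * (N * (2 * (M * ?E)))"
      using vort_square_le_enstrophy[of i j y s] by simp
    finally show ?thesis by (simp add: algebra_simps)
  qed
  have eq: "(\<Sum>i\<in>UNIV. \<Sum>j\<in>UNIV. 2 * vort i j y s * (DW y s (axis i 1) $ j - DW y s (axis j 1) $ i))
    + (\<Sum>i\<in>UNIV. \<Sum>j\<in>UNIV. 2 * vort i j y s *
        (D2V y s (c *\<^sub>R y + V y s) (axis i 1) $ j - D2V y s (c *\<^sub>R y + V y s) (axis j 1) $ i))
    = (\<Sum>i\<in>UNIV. \<Sum>j\<in>UNIV. ?R i j)"
    unfolding sum.distrib[symmetric] distrib_left[symmetric] vorticity_equation ..
  have "\<bar>\<Sum>i\<in>UNIV. \<Sum>j\<in>UNIV. ?R i j\<bar> \<le> (\<Sum>i\<in>(UNIV :: 'n set). \<Sum>j\<in>(UNIV :: 'n set). 2 * (1 + N * (2 * M)) * ?E)"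
    by (intro order_trans[OF sum_abs] sum_mono R)
  also have "\<dots> = N * (N * (2 * (1 + N * (2 * M)))) * ?E" by (simp only: sum_constant N_def mult.assoc)
  finally show ?thesis unfolding eq .
qed

section \<open>Enlarging the ball on which the solution vanishes\<close>

lemma DV_eq_0:
  assumes "open A" "y \<in> A" "\<And>z. z \<in> A \<Longrightarrow> V z s = 0"
  shows "DV y s = 0"
proof -
  have "((\<lambda>z. V z s) has_derivative (\<lambda>h. 0)) (at y)"
    by (rule has_derivative_transform_within_open[of "\<lambda>_. 0" _ _ _ A]) (use assms in auto)
  from has_derivative_unique[OF DV this] show ?thesis
    by (intro blinfun_eqI) simp
qed

text \<open>For a curl free field the Laplacian of component i is the i-th derivative of the
  divergence, hence zero; each component is harmonic in the ball and vanishes near the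
  origin.\<close>

lemma curl_free_imp_zero:
  assumes r: "r > 0" and zero: "\<And>y. norm y < r \<Longrightarrow> V y s = 0"
    and curl: "\<And>i j y. norm y < R \<Longrightarrow> vort i j y s = 0" and y: "norm y < R"
  shows "V y s = 0"
proof (rule vec_eq_iff[THEN iffD2], rule allI)
  fix i
  have sym: "D2V z s h (axis k 1) $ l = D2V z s h (axis l 1) $ k" if z: "norm z < R" for z h k l
  proof -
    have "((\<lambda>z. vort k l z s) has_derivative (\<lambda>h. 0)) (at z)"
      by (rule has_derivative_transform_within_open[of "\<lambda>_. 0" _ _ _ "ball 0 R"])
        (use z curl in auto)
    from fun_cong[OF has_derivative_unique[OF vort_has_derivative this], of h] show ?thesis by simp
  qed
  have div: "(\<Sum>j\<in>UNIV. D2V z s h (axis j 1) $ j) = 0" for z h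
  proof -
    have "((\<lambda>z. \<Sum>j\<in>UNIV. DV z s (axis j 1) $ j) has_derivative (\<lambda>h. \<Sum>j\<in>UNIV. D2V z s h (axis j 1) $ j)) (at z)"
      by (intro has_derivative_sum D2V_component)
    then have "((\<lambda>z. 0) has_derivative (\<lambda>h. \<Sum>j\<in>UNIV. D2V z s h (axis j 1) $ j)) (at z)"
      unfolding div_free .
    from fun_cong[OF has_derivative_unique[OF this has_derivative_const], of h] show ?thesis by simp
  qed
  have "V y s $ i = 0"
  proof (rule harmonic_unique_continuation[where R = R and r = r and u = "\<lambda>z. V z s $ i"])
    show "has_partial j (\<lambda>z. V z s $ i) (\<lambda>z. DV z s (axis j 1) $ i)" for j
      by (rule has_partial_of_has_derivative[OF DV_component])
    show "has_partial j (\<lambda>z. DV z s (axis j 1) $ i) (\<lambda>z. D2V z s (axis j 1) (axis j 1) $ i)" for j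
      by (rule has_partial_of_has_derivative[OF D2V_component])
    show "(\<Sum>j\<in>UNIV. D2V z s (axis j 1) (axis j 1) $ i) = 0" if z: "norm z < R" for z
    proof -
      have "(\<Sum>j\<in>UNIV. D2V z s (axis j 1) (axis j 1) $ i) = (\<Sum>j\<in>UNIV. D2V z s (axis j 1) (axis i 1) $ j)"
        by (rule sum.cong[OF refl sym[OF z]])
      also have "\<dots> = (\<Sum>j\<in>UNIV. D2V z s (axis i 1) (axis j 1) $ j)"
        by (subst D2V_symmetric) (rule refl)
      also have "\<dots> = 0" by (rule div)
      finally show ?thesis .
    qed
  qed (use r y zero in \<open>auto intro!: continuous_intros\<close>)
  then show "V y s $ i = 0 $ i" by simp
qed

lemma vanishing_extends:
  assumes r: "r > 0" and zero: "\<And>y s. norm y \<le> r \<Longrightarrow> V y s = 0"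
  shows "\<exists>R>r. \<forall>y s. norm y \<le> R \<longrightarrow> V y s = 0"
proof -
  let ?K = "cball (0::real^'n) (r + 1) \<times> {0..S}"
  have compact: "compact ?K" by (intro compact_Times) auto
  have rep: "\<exists>s'\<in>{0..S}. V y s = V y s' \<and> DV y s = DV y s'" for y s
    using periodic_representative[OF S, of "\<lambda>s. (V y s, DV y s)"] periodic DV_periodic by (metis prod.inject)
  \<comment> \<open>If |V| is at most this, then V . y is at most half of |c| |y|^2 in size for |y|
    \<ge> r, so the drift keeps at least half of its radial component.\<close>
  define \<epsilon> where "\<epsilon> = \<bar>c\<bar> * r / 2"
  have "\<epsilon> > 0" using coeffs(2) r by (simp add: \<epsilon>_def)
  have "continuous_on ?K (\<lambda>p. V (fst p) (snd p))" by (intro continuous_intros)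
  from compact_uniformly_continuous[OF this compact] \<open>\<epsilon> > 0\<close>
  obtain \<delta> where \<delta>: "\<delta> > 0" "\<And>p p'. \<lbrakk>p \<in> ?K; p' \<in> ?K; dist p' p < \<delta>\<rbrakk> \<Longrightarrow>
      dist (V (fst p') (snd p')) (V (fst p) (snd p)) < \<epsilon>"
    unfolding uniformly_continuous_on_def by blast
  \<comment> \<open>The 1 keeps the shell inside the compact set \<open>?K\<close>; half of \<delta>
    keeps its points strictly closer than \<delta> to the sphere of radius \<open>r\<close>.\<close>
  define R where "R = r + min (\<delta> / 2) 1"
  have R: "r < R" "R \<le> r + 1" "R < r + \<delta>" using \<delta>(1) by (auto simp: R_def)
  have small: "norm (V y s) \<le> \<epsilon>" if y: "r \<le> norm y" "norm y \<le> R" for y s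
  proof -
    obtain s' where s': "s' \<in> {0..S}" "V y s = V y s'" using rep by blast
    \<comment> \<open>The radial projection onto the sphere of radius \<open>r\<close>, where
      \<open>V\<close> is zero.\<close>
    let ?y = "(r / norm y) *\<^sub>R y"
    have ny: "norm ?y = r" using y r by (auto simp: divide_simps)
    have "dist y ?y = norm ((1 - r / norm y) *\<^sub>R y)" by (simp add: dist_norm algebra_simps)
    also have "\<dots> = (1 - r / norm y) * norm y"
      using y r by (simp only: norm_scaleR real_norm_def) (simp add: divide_le_eq)
    also have "\<dots> = norm y - r" using less_le_trans[OF r y(1)] by (simp add: left_diff_distrib)
    finally have "dist (y, s') (?y, s') < \<delta>" using y R by (simp add: dist_Pair_Pair)
    then have "dist (V y s') (V ?y s') < \<epsilon>"
      using \<delta>(2)[of "(?y, s')" "(y, s')"] ny y s' R by simp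
    then show ?thesis using zero[of ?y s'] ny s' by simp
  qed
  \<comment> \<open>The factor \<open>sgn c\<close> reverses the field when it points inward, so
    that both signs reduce to the outward case.\<close>
  define b where "b y s = sgn c *\<^sub>R (c *\<^sub>R y + V y s)" for y s
  have out: "\<bar>c\<bar> * r * (r / 2) \<le> b y s \<bullet> y" if y: "r \<le> norm y" "norm y \<le> R" for y s
  proof -
    have "\<bar>sgn c * (V y s \<bullet> y)\<bar> \<le> norm (V y s) * norm y"
      using Cauchy_Schwarz_ineq2[of "V y s" y] coeffs(2) by (simp add: abs_mult abs_sgn_eq)
    also have "\<dots> \<le> \<epsilon> * norm y" by (intro mult_right_mono small y) simp
    finally have "- (\<epsilon> * norm y) \<le> sgn c * (V y s \<bullet> y)" by linarith
    moreover have "b y s \<bullet> y = \<bar>c\<bar> * (norm y)\<^sup>2 + sgn c * (V y s \<bullet> y)"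
      by (simp add: b_def inner_add_left power2_norm_eq_inner abs_sgn algebra_simps)
    moreover have "\<bar>c\<bar> * r * (r / 2) \<le> \<bar>c\<bar> * norm y * (norm y - r / 2)"
      using y r by (intro mult_mono) auto
    ultimately show ?thesis by (simp add: \<epsilon>_def algebra_simps power2_eq_square)
  qed
  have "continuous_on ?K (\<lambda>p. DV (fst p) (snd p))" by (intro continuous_intros)
  from compact_imp_bounded[OF compact_continuous_image[OF this compact]]
  obtain M where M: "\<And>p. p \<in> ?K \<Longrightarrow> norm (DV (fst p) (snd p)) \<le> M"
    unfolding bounded_iff by blast
  have DV_le: "norm (DV y s) \<le> M" if "norm y \<le> R" for y s
  proof -
    obtain s' where "s' \<in> {0..S}" "DV y s = DV y s'" using rep by blast
    then show ?thesis using M[of "(y, s')"] that R by simp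
  qed
  define N where "N = real CARD('n)"
  let ?f' = "\<lambda>y s h. \<Sum>i\<in>UNIV. \<Sum>j\<in>UNIV.
     2 * vort i j y s * (D2V y s h (axis i 1) $ j - D2V y s h (axis j 1) $ i)"
  let ?ft = "\<lambda>y s. \<Sum>i\<in>UNIV. \<Sum>j\<in>UNIV.
     2 * vort i j y s * (DW y s (axis i 1) $ j - DW y s (axis j 1) $ i)"
  have enst: "enstrophy y s = 0" if y: "norm y \<le> R" for y s
  proof (rule periodic_transport_vanishing[where f = enstrophy and ft = ?ft and f' = ?f' and b = b,
        OF S _ _ enstrophy_has_time_derivative enstrophy_has_derivative enstrophy_nonneg _ out _ _ y])
    show "enstrophy y (s + S) = enstrophy y s" for y s
      by (simp add: enstrophy_def vort_def DV_periodic)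
    show "continuous_on UNIV (\<lambda>(y, s). enstrophy y s)"
      unfolding split_beta enstrophy_def vort_def by (intro continuous_intros)
    show "0 < \<bar>c\<bar> * r * (r / 2)" using r coeffs(2) by simp
    show "enstrophy y s = 0" if "norm y < r" for y s
    proof -
      have "DV y s = 0" by (rule DV_eq_0[of "ball 0 r"]) (use that zero in auto)
      then show ?thesis by (simp add: enstrophy_def vort_def)
    qed
    fix y s assume y: "norm y \<le> R" and ft: "?ft y s = 0"
    \<comment> \<open>Where the time derivative is zero, the two-sided bound controls the derivative
      along c y + V in absolute value, hence along \<open>b\<close> for either sign of
      \<open>c\<close>.\<close>
    have "?f' y s (b y s) = sgn c * ?f' y s (c *\<^sub>R y + V y s)"
      unfolding b_def
      by (rule linear_cmul[OF has_derivative_linear[OF enstrophy_has_derivative], unfolded real_scaleR_def])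
    also have "\<dots> \<le> \<bar>?f' y s (c *\<^sub>R y + V y s)\<bar>"
      using coeffs(2) by (cases "c > 0") (auto simp: sgn_if)
    also have "\<dots> \<le> N * (N * (2 * (1 + N * (2 * M)))) * enstrophy y s"
      using enstrophy_transport_bound[OF DV_le[OF y], of s] unfolding ft N_def by simp
    finally show "?f' y s (b y s) \<le> N * (N * (2 * (1 + N * (2 * M)))) * enstrophy y s" .
  qed auto
  \<comment> \<open>Unique continuation reaches only the open ball of radius \<open>R\<close>; the
    midpoint supplies a closed ball that is still larger than the old one.\<close>
  have "V y s = 0" if "norm y \<le> (r + R) / 2" for y s
  proof (rule curl_free_imp_zero[OF r])
    show "vort i j z s = 0" if "norm z < R" for i j z
      using vort_square_le_enstrophy[of i j z s] enst[of z s] that by simp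
  qed (use that R zero in auto)
  then show ?thesis using R by (intro exI[of _ "(r + R) / 2"]) auto
qed

text \<open>The gain in radius supplied by \<open>vanishing_extends\<close> has no uniform lower
  bound, so repeating it need not exhaust the space. Instead, continuity shows that the supremum of
  the admissible radii is itself admissible, and one further extension contradicts it.\<close>

lemma vanishing:
  assumes r0: "r0 > 0" and zero: "\<And>y s. norm y < r0 \<Longrightarrow> V y s = 0"
  shows "V y s = 0"
proof (rule ccontr)
  assume nz: "V y s \<noteq> 0"
  define T where "T = {r. r > 0 \<and> (\<forall>y s. norm y \<le> r \<longrightarrow> V y s = 0)}"
  have le: "r \<le> norm y" if "r \<in> T" for r
    using that nz by (force simp: T_def)
  have bdd: "bdd_above T" by (rule bdd_aboveI) (rule le)
  have r0T: "r0 / 2 \<in> T" using r0 zero by (auto simp: T_def)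
  define R where "R = Sup T"
  have up: "r \<le> R" if "r \<in> T" for r unfolding R_def by (rule cSup_upper[OF that bdd])
  have R: "R > 0" using up[OF r0T] r0 by simp
  have open_ball: "V z t = 0" if z: "norm z < R" for z t
  proof -
    obtain r where "r \<in> T" "norm z < r"
      using less_cSup_iff[of T "norm z"] bdd r0T z unfolding R_def by blast
    then show ?thesis by (auto simp: T_def)
  qed
  have "V z t = 0" if "norm z \<le> R" for z t
  proof -
    have "continuous_on (closure (ball 0 R)) (\<lambda>z. V z t)" by (intro continuous_intros)
    from continuous_constant_on_closure[OF this, of 0] show ?thesis
      using open_ball R that by simp
  qed
  from vanishing_extends[OF R this] obtain R' where "R' > R" "R' \<in> T"
    using R by (auto simp: T_def)
  with up show False by force
qed

end

section \<open>Translation of the self-similar system into the abstract setting\<close>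

theorem theorem1p1:
  fixes \<alpha> S\<^sub>0 :: real
    and V :: "real^3 \<Rightarrow> real \<Rightarrow> real^3"
    and P :: "real^3 \<Rightarrow> real \<Rightarrow> real"
  assumes "\<alpha> \<noteq> -1"
    and "S\<^sub>0 > 0"
    and "C1_time_C2_space V"
    and "time_periodic_solution \<alpha> S\<^sub>0 V P"
    and "\<exists>G. open G \<and> 0 \<in> G \<and> (\<forall>y\<in>G. \<forall>s\<in>{0<..<S\<^sub>0}. V y s = 0)"
  shows "\<forall>y s. V y s = 0"
proof -
  obtain DV D2V where DV: "\<And>y s. ((\<lambda>z. V z s) has_derivative blinfun_apply (DV y s)) (at y)"
    and D2V: "\<And>y s. ((\<lambda>z. DV z s) has_derivative blinfun_apply (D2V y s)) (at y)"
    and cont: "continuous_on UNIV (\<lambda>(y, s). V y s)" "continuous_on UNIV (\<lambda>(y, s). DV y s)"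
      "continuous_on UNIV (\<lambda>(y, s). D2V y s)"
    using assms(3) unfolding C1_time_C2_space_def C2_space_def by blast
  obtain W where W: "\<And>y s. ((\<lambda>t. V y t) has_vector_derivative W y s) (at s)" and "C2_space W"
    using assms(3) unfolding C1_time_C2_space_def by blast
  then obtain DW where DW: "\<And>y s. ((\<lambda>z. W z s) has_derivative blinfun_apply (DW y s)) (at y)"
    and contDW: "continuous_on UNIV (\<lambda>(y, s). DW y s)"
    unfolding C2_space_def by blast
  have euler: "\<And>y s. (\<lambda>z. P z s) differentiable (at y)"
    "\<And>y s. vector_derivative (\<lambda>t. V y t) (at s) + (\<alpha> / (\<alpha> + 1)) *\<^sub>R V y s
        + (1 / (\<alpha> + 1)) *\<^sub>R advect y (\<lambda>z. V z s) y + advect (V y s) (\<lambda>z. V z s) y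
      = - grad (\<lambda>z. P z s) y"
    "\<And>y s. divergence (\<lambda>z. V z s) y = 0"
    and per: "\<And>y s. V y (s + S\<^sub>0) = V y s"
    using assms(4) unfolding time_periodic_solution_def self_similar_euler_def by metis+
  have partial_V: "partial j (\<lambda>z. V z s) y = DV y s (axis j 1)" for j y s
    unfolding partial_def
    using has_vector_derivative_line[OF DV, of y "axis j 1" s 0] by (simp add: vector_derivative_at)
  have advect_V: "advect v (\<lambda>z. V z s) y = DV y s v" for v y s
    unfolding advect_def partial_V
    by (rule linear_vec_expansion[symmetric]) (rule bounded_linear.linear[OF blinfun.bounded_linear_right])
  have partial_P: "has_partial j (\<lambda>z. P z s) (\<lambda>y. grad (\<lambda>z. P z s) y $ j)" for j s
  proof -
    obtain P' where P': "\<And>y. ((\<lambda>z. P z s) has_derivative P' y) (at y)"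
      using euler(1) unfolding differentiable_def by metis
    have "grad (\<lambda>z. P z s) y $ j = P' y (axis j 1)" for y
      unfolding grad_def partial_def
      using has_vector_derivative_line[OF P', of y "axis j 1" 0] by (simp add: vector_derivative_at)
    then show ?thesis using has_partial_of_has_derivative[OF P'] by simp
  qed
  \<comment> \<open>By linearity of \<open>DV y s\<close> the two advection terms merge into one
    derivative along the full transporting field.\<close>
  have grad_P: "grad (\<lambda>z. P z s) y =
      - (W y s + (\<alpha> / (\<alpha> + 1)) *\<^sub>R V y s + DV y s ((1 / (\<alpha> + 1)) *\<^sub>R y + V y s))" for y s
    using euler(2)[of y s] unfolding advect_V vector_derivative_at[OF W]
    by (simp add: blinfun.add_right blinfun.scaleR_right add.assoc)
  interpret periodic_euler "\<alpha> / (\<alpha> + 1)" "1 / (\<alpha> + 1)" S\<^sub>0 V W DV DW D2V P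
  proof
    show "has_partial j (\<lambda>y. P y s) (\<lambda>y. - (W y s + (\<alpha> / (\<alpha> + 1)) *\<^sub>R V y s
        + DV y s ((1 / (\<alpha> + 1)) *\<^sub>R y + V y s)) $ j)" for j s
      using partial_P[of j s] unfolding grad_P by simp
    show "(\<Sum>j\<in>UNIV. DV y s (axis j 1) $ j) = 0" for y s
      using euler(3)[of s y] unfolding divergence_def partial_V .
    show "\<alpha> / (\<alpha> + 1) + 1 / (\<alpha> + 1) = 1" "1 / (\<alpha> + 1) \<noteq> 0"
      using assms(1) by (auto simp: add_eq_0_iff simp flip: add_divide_distrib)
  qed (fact DV D2V W DW cont contDW per assms(2))+
  obtain G where G: "open G" "0 \<in> G" "\<And>y s. \<lbrakk>y \<in> G; s \<in> {0<..<S\<^sub>0}\<rbrakk> \<Longrightarrow> V y s = 0"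
    using assms(5) by blast
  obtain r where r: "r > 0" "ball 0 r \<subseteq> G" using G(1,2) open_contains_ball by blast
  have "V y s = 0" if y: "norm y < r" for y s
  proof -
    \<comment> \<open>The hypothesis covers only the open time interval; continuity adds its
      endpoints, and periodicity then gives all times.\<close>
    have "continuous_on (closure {0<..<S\<^sub>0}) (\<lambda>s. V y s)" by (intro continuous_intros)
    from continuous_constant_on_closure[OF this, of 0] have "V y s = 0" if "s \<in> {0..S\<^sub>0}" for s
      using G(3)[of y] r(2) y assms(2) that by auto
    then show ?thesis
      using periodic_representative[OF assms(2), of "V y" s] per by metis
  qed
  from vanishing[OF r(1) this] show ?thesis by blast
qed

end
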